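(* Let $n\ge 4$, and assume that the Gasca–Maeztu conjecture holds for all degrees up to $n$, i.e. for every $1\le k\le n$ every $GC_k$ set possesses a maximal line. Let $\mathcal X$ be a $GC_n$ set with exactly three maximal lines. Then there are exactly three $n$-node lines in $\mathcal X$, and each of them is used by exactly $\binom n2$ nodes from $\mathcal X$.
   Context: $\Pi_n$ denotes the space of real bivariate polynomials of total degree at most $n$; $\dim\Pi_n=\binom{n+2}{2}$. A finite set $\mathcal X$ of distinct points (nodes) in the plane is $n$-poised if for arbitrary prescribed values at the nodes there is a unique $p\in\Pi_n$ taking these values; then $|\mathcal X|=\binom{n+2}{2}$. For an $n$-poised set $\mathcal X$ and $A\in\mathcal X$, the ($n$-)fundamental polynomial $p_A^\star\in\Pi_n$ is the one equal to $1$ at $A$ and $0$ at all other nodes. An $n$-poised set is a $GC_n$ set if the fundamental polynomial of each of its nodes is a product of $n$ linear factors (polynomials of degree one). A line is identified with a degree-one polynomial defining it. A node $A\in\mathcal X$ uses a line $\ell$ if $p_A^\star=\ell q$ for some $q\in\Pi_{n-1}$. A $k$-node line is a line passing through exactly $k$ nodes of $\mathcal X$; a maximal line of an $n$-poised (in particular $GC_n$) set is an $(n+1)$-node line. *)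

theory Defs
  imports Complex_Main
begin

text \<open>
  The plane is \<open>real \<times> real\<close>. Real bivariate polynomials are represented by the functions they
  induce on the plane; as the reals are infinite, this identification is faithful.
\<close>

definition poly_space :: "nat \<Rightarrow> (real \<times> real \<Rightarrow> real) set" where
  "poly_space n =
     {f. \<exists>c :: nat \<Rightarrow> nat \<Rightarrow> real. f = (\<lambda>(x, y). \<Sum>i\<le>n. \<Sum>j\<le>n - i. c i j * x ^ i * y ^ j)}"

definition poised :: "nat \<Rightarrow> (real \<times> real) set \<Rightarrow> bool" where
  "poised n X \<longleftrightarrow> finite X \<and>
     (\<forall>v :: real \<times> real \<Rightarrow> real. \<exists>!p. p \<in> poly_space n \<and> (\<forall>A\<in>X. p A = v A))"

text \<open>Meaningful only for \<open>poised n X\<close> and \<open>A \<in> X\<close>.\<close>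

definition fundamental_poly ::
    "nat \<Rightarrow> (real \<times> real) set \<Rightarrow> real \<times> real \<Rightarrow> (real \<times> real \<Rightarrow> real)" where
  "fundamental_poly n X A =
     (THE p. p \<in> poly_space n \<and> p A = 1 \<and> (\<forall>B\<in>X - {A}. p B = 0))"

definition linear_poly :: "(real \<times> real \<Rightarrow> real) \<Rightarrow> bool" where
  "linear_poly f \<longleftrightarrow> f \<in> poly_space 1 \<and> f \<notin> poly_space 0"

definition GC_set :: "nat \<Rightarrow> (real \<times> real) set \<Rightarrow> bool" where
  "GC_set n X \<longleftrightarrow> poised n X \<and>
     (\<forall>A\<in>X. \<exists>L :: nat \<Rightarrow> real \<times> real \<Rightarrow> real.
        (\<forall>i<n. linear_poly (L i)) \<and> fundamental_poly n X A = (\<lambda>z. \<Prod>i<n. L i z))"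

text \<open>
  A degree-one polynomial defining a line is determined only up to a nonzero scalar, so, in order
  to be able to count lines, a line is taken to be the zero set of such a polynomial.
\<close>

definition defines_line :: "(real \<times> real \<Rightarrow> real) \<Rightarrow> (real \<times> real) set \<Rightarrow> bool" where
  "defines_line f l \<longleftrightarrow> linear_poly f \<and> l = {z. f z = 0}"

definition is_line :: "(real \<times> real) set \<Rightarrow> bool" where
  "is_line l \<longleftrightarrow> (\<exists>f. defines_line f l)"

definition node_line :: "nat \<Rightarrow> (real \<times> real) set \<Rightarrow> (real \<times> real) set \<Rightarrow> bool" where
  "node_line k X l \<longleftrightarrow> is_line l \<and> finite (l \<inter> X) \<and> card (l \<inter> X) = k"

definition maximal_line :: "nat \<Rightarrow> (real \<times> real) set \<Rightarrow> (real \<times> real) set \<Rightarrow> bool" where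
  "maximal_line n X l \<longleftrightarrow> node_line (n + 1) X l"

text \<open>The degree bound \<open>n - 1\<close> is truncated subtraction, so this is meant for \<open>n \<ge> 1\<close>.\<close>

definition uses_line ::
    "nat \<Rightarrow> (real \<times> real) set \<Rightarrow> real \<times> real \<Rightarrow> (real \<times> real) set \<Rightarrow> bool" where
  "uses_line n X A l \<longleftrightarrow>
     (\<exists>f q. defines_line f l \<and> q \<in> poly_space (n - 1) \<and>
        fundamental_poly n X A = (\<lambda>z. f z * q z))"

definition Gasca_Maeztu :: "nat \<Rightarrow> bool" where
  "Gasca_Maeztu k \<longleftrightarrow> (\<forall>Y. GC_set k Y \<longrightarrow> (\<exists>l. maximal_line k Y l))"

end

theory Submission
  imports Defs "HOL-Computational_Algebra.Polynomial"
begin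

text \<open>
  Removing a maximal line from a \<open>GC\<close> set of degree \<open>n\<close> leaves a \<open>GC\<close> set of degree \<open>n - 1\<close>. The key
  fact: if \<open>l\<close> is maximal in \<open>X\<close>, then of any two maximal lines of \<open>X - l\<close> at least one meets
  \<open>l\<close> in a node and hence is maximal in \<open>X\<close>. Otherwise let \<open>P\<close> be the common node of these two lines
  \<open>m1\<close>, \<open>m2\<close>. Each node \<open>A\<close> on \<open>l\<close> uses a line through \<open>P\<close>, and different \<open>A\<close> use different
  lines, by counting zeros. A third maximal line of \<open>X - l\<close> either misses \<open>l\<close>, and then has too few
  nodes to be met by all these lines, or is maximal in \<open>X\<close> and can be removed to lower the degree.

  So if \<open>X\<close> has exactly the maximal lines \<open>a\<close>, \<open>b\<close>, \<open>c\<close>, then \<open>X - a\<close> has exactly the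
  maximal lines \<open>a'\<close>, \<open>b\<close>, \<open>c\<close>, where \<open>a'\<close> is an \<open>n\<close>-node line that misses \<open>a\<close>; likewise for
  \<open>b'\<close>, \<open>c'\<close>. Every \<open>n\<close>-node line misses the nodes of one of \<open>a\<close>, \<open>b\<close>, \<open>c\<close>: this is proved by
  induction from \<open>n = 4\<close>. Hence it is one of \<open>a'\<close>, \<open>b'\<close>, \<open>c'\<close>. The nodes using \<open>a'\<close> are
  those of \<open>X - a - a'\<close>.
\<close>

section \<open>Division by linear factors\<close>

lemma poly_space_0: "poly_space 0 = {f. \<exists>c. f = (\<lambda>_. c)}"
  by (auto simp: poly_space_def fun_eq_iff)

lemma poly_space_add:
  assumes "p \<in> poly_space n" "q \<in> poly_space n"
  shows "(\<lambda>z. p z + q z) \<in> poly_space n"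
proof -
  from assms obtain c d where p: "p = (\<lambda>(x, y). \<Sum>i\<le>n. \<Sum>j\<le>n - i. c i j * x ^ i * y ^ j)"
    and q: "q = (\<lambda>(x, y). \<Sum>i\<le>n. \<Sum>j\<le>n - i. d i j * x ^ i * y ^ j)"
    by (auto simp: poly_space_def)
  show ?thesis unfolding poly_space_def mem_Collect_eq
    by (rule exI[of _ "\<lambda>i j. c i j + d i j"])
       (auto simp: p q fun_eq_iff sum.distrib algebra_simps)
qed

lemma poly_space_scale:
  assumes "p \<in> poly_space n"
  shows "(\<lambda>z. a * p z) \<in> poly_space n"
proof -
  from assms obtain c where p: "p = (\<lambda>(x, y). \<Sum>i\<le>n. \<Sum>j\<le>n - i. c i j * x ^ i * y ^ j)"
    by (auto simp: poly_space_def)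
  show ?thesis unfolding poly_space_def mem_Collect_eq
    by (rule exI[of _ "\<lambda>i j. a * c i j"])
       (auto simp: p fun_eq_iff sum_distrib_left algebra_simps)
qed

lemma poly_space_monom:
  assumes "i + j \<le> n"
  shows "(\<lambda>(x, y). x ^ i * y ^ j) \<in> poly_space n"
proof -
  have "(\<Sum>i'\<le>n. \<Sum>j'\<le>n - i'. (if i' = i \<and> j' = j then 1 else 0) * x ^ i' * y ^ j') = x ^ i * y ^ j"
    for x y :: real
  proof -
    have "(\<Sum>j'\<le>n - i'. (if i' = i \<and> j' = j then 1 else 0) * x ^ i' * y ^ j')
        = (if i' = i then x ^ i * y ^ j else 0)" for i'
    proof (cases "i' = i")
      case True
      have "(\<Sum>j'\<le>n - i'. (if i' = i \<and> j' = j then 1 else 0) * x ^ i' * y ^ j')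
          = (\<Sum>j'\<le>n - i'. if j' = j then x ^ i * y ^ j else 0)"
        by (intro sum.cong) (auto simp: True)
      also have "\<dots> = x ^ i * y ^ j" using assms True by simp
      finally show ?thesis using True by simp
    qed auto
    then show ?thesis using assms by simp
  qed
  then show ?thesis unfolding poly_space_def mem_Collect_eq
    by (intro exI[of _ "\<lambda>i' j'. if i' = i \<and> j' = j then 1 else 0"]) (auto simp: fun_eq_iff)
qed

lemma poly_space_zero: "(\<lambda>_. 0) \<in> poly_space n"
  using poly_space_scale[OF poly_space_monom[of 0 0 n], of 0] by simp

lemma poly_space_const: "(\<lambda>_. c) \<in> poly_space n"
  using poly_space_scale[OF poly_space_monom[of 0 0 n], of c] by simp

lemma poly_space_sum:
  assumes "finite I" "\<And>i. i \<in> I \<Longrightarrow> f i \<in> poly_space n"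
  shows "(\<lambda>z. \<Sum>i\<in>I. f i z) \<in> poly_space n"
  using assms by (induction I) (auto intro: poly_space_zero poly_space_add)

text \<open>Reduces closure proofs to monomials. The zero function gets no case of its own, being 0
  times the monomial 1.\<close>

lemma poly_space_induct [consumes 1, case_names monom scale add]:
  assumes p: "p \<in> poly_space n"
    and monom: "\<And>i j. i + j \<le> n \<Longrightarrow> P (\<lambda>(x, y). x ^ i * y ^ j)"
    and scale: "\<And>a q. P q \<Longrightarrow> P (\<lambda>z. a * q z)"
    and add: "\<And>q r. P q \<Longrightarrow> P r \<Longrightarrow> P (\<lambda>z. q z + r z)"
  shows "P p"
proof -
  have zero: "P (\<lambda>_. 0)" using scale[OF monom[of 0 0], of 0] by simp
  have sum: "P (\<lambda>z. \<Sum>i\<in>I. f i z)" if "finite I" "\<And>i. i \<in> I \<Longrightarrow> P (f i)"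
    for I and f :: "nat \<Rightarrow> real \<times> real \<Rightarrow> real"
    using that by (induction I) (auto intro: zero add)
  from p obtain c where c: "p = (\<lambda>(x, y). \<Sum>i\<le>n. \<Sum>j\<le>n - i. c i j * x ^ i * y ^ j)"
    by (auto simp: poly_space_def)
  then have "p = (\<lambda>z. \<Sum>i\<le>n. \<Sum>j\<le>n - i. c i j * (case z of (x, y) \<Rightarrow> x ^ i * y ^ j))"
    by (auto simp: fun_eq_iff mult.assoc)
  moreover have "P (\<lambda>z. \<Sum>i\<le>n. \<Sum>j\<le>n - i. c i j * (case z of (x, y) \<Rightarrow> x ^ i * y ^ j))"
    by (intro sum scale monom) auto
  ultimately show ?thesis by simp
qed

lemma poly_space_mult:
  assumes "p \<in> poly_space m" "q \<in> poly_space n"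
  shows "(\<lambda>z. p z * q z) \<in> poly_space (m + n)"
  using assms(1)
proof (induction rule: poly_space_induct)
  case (monom i j)
  show ?case using assms(2)
  proof (induction rule: poly_space_induct)
    case (monom k l)
    have "(\<lambda>(x, y). x ^ (i + k) * y ^ (j + l)) \<in> poly_space (m + n)"
      using \<open>i + j \<le> m\<close> monom by (intro poly_space_monom) auto
    also have "(\<lambda>(x :: real, y :: real). x ^ (i + k) * y ^ (j + l)) =
       (\<lambda>z. (case z of (x, y) \<Rightarrow> x ^ i * y ^ j) * (case z of (x, y) \<Rightarrow> x ^ k * y ^ l))"
      by (auto simp: fun_eq_iff power_add mult_ac)
    finally show ?case .
  next
    case (scale a q)
    then show ?case using poly_space_scale[of _ "m + n" a] by (fastforce simp: mult.left_commute)
  next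
    case (add q r)
    then show ?case using poly_space_add by (fastforce simp: distrib_left)
  qed
next
  case (scale a q)
  then show ?case using poly_space_scale[of _ "m + n" a] by (fastforce simp: mult.assoc)
next
  case (add q r)
  then show ?case using poly_space_add by (fastforce simp: distrib_right)
qed

lemma poly_space_mono:
  assumes "p \<in> poly_space m" "m \<le> n"
  shows "p \<in> poly_space n"
  using assms(1)
  by (induction rule: poly_space_induct)
     (use assms(2) in \<open>auto intro: poly_space_monom poly_space_scale poly_space_add\<close>)

lemma poly_space_swap:
  assumes "p \<in> poly_space n"
  shows "p \<circ> prod.swap \<in> poly_space n"
  using assms
proof (induction rule: poly_space_induct)
  case (monom i j)
  have "(\<lambda>(x, y). x ^ i * y ^ j :: real) \<circ> prod.swap = (\<lambda>(x, y). x ^ j * y ^ i)"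
    by (auto simp: fun_eq_iff)
  then show ?case using monom by (auto intro: poly_space_monom)
next
  case (scale a q)
  then show ?case using poly_space_scale[of "q \<circ> prod.swap"] by (simp add: o_def)
next
  case (add q r)
  then show ?case using poly_space_add[of "q \<circ> prod.swap" n "r \<circ> prod.swap"] by (simp add: o_def)
qed

text \<open>Polynomials of degree less than \<open>k\<close>; unlike \<open>poly_space (k - 1)\<close>, this is the zero space
  for \<open>k = 0\<close>, which makes division by linear factors uniform.\<close>

definition deg_less :: "nat \<Rightarrow> (real \<times> real \<Rightarrow> real) set" where
  "deg_less k = (if k = 0 then {\<lambda>_. 0} else poly_space (k - 1))"

lemma deg_less_Suc [simp]: "deg_less (Suc k) = poly_space k"
  by (simp add: deg_less_def)

lemma deg_less_add: "p \<in> deg_less k \<Longrightarrow> q \<in> deg_less k \<Longrightarrow> (\<lambda>z. p z + q z) \<in> deg_less k"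
  by (auto simp: deg_less_def poly_space_add)

lemma deg_less_scale: "p \<in> deg_less k \<Longrightarrow> (\<lambda>z. a * p z) \<in> deg_less k"
  by (auto simp: deg_less_def poly_space_scale)

lemma deg_less_zero: "(\<lambda>_. 0) \<in> deg_less k"
  by (auto simp: deg_less_def poly_space_zero)

lemma deg_less_swap: "p \<in> deg_less k \<Longrightarrow> p \<circ> prod.swap \<in> deg_less k"
  by (auto simp: deg_less_def poly_space_swap)

lemma deg_less_mult: "p \<in> poly_space m \<Longrightarrow> q \<in> deg_less k \<Longrightarrow> (\<lambda>z. p z * q z) \<in> deg_less (m + k)"
  using poly_space_mult[of p m q "k - 1"] by (cases k) (auto simp: deg_less_def poly_space_zero)

lemma linear_poly_iff:
  "linear_poly f \<longleftrightarrow> (\<exists>a b c. (a \<noteq> 0 \<or> b \<noteq> 0) \<and> f = (\<lambda>(x, y). a * x + b * y + c))"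
proof
  assume f: "linear_poly f"
  then obtain c where c: "f = (\<lambda>(x, y). \<Sum>i\<le>1. \<Sum>j\<le>1 - i. c i j * x ^ i * y ^ j)"
    by (auto simp: linear_poly_def poly_space_def)
  have *: "f = (\<lambda>(x, y). c 1 0 * x + c 0 1 * y + c 0 0)"
    by (auto simp: c fun_eq_iff)
  have "c 1 0 \<noteq> 0 \<or> c 0 1 \<noteq> 0"
      proof (rule ccontr)
    assume "\<not> ?thesis"
    then have "f = (\<lambda>_. c 0 0)" using * by auto
    then show False using f by (auto simp: linear_poly_def poly_space_0)
  qed
  with * show "\<exists>a b c. (a \<noteq> 0 \<or> b \<noteq> 0) \<and> f = (\<lambda>(x, y). a * x + b * y + c)" by blast
next
  assume "\<exists>a b c. (a \<noteq> 0 \<or> b \<noteq> 0) \<and> f = (\<lambda>(x, y). a * x + b * y + c)"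
  then obtain a b c where ab: "a \<noteq> 0 \<or> b \<noteq> 0" and f: "f = (\<lambda>(x, y). a * x + b * y + c)" by blast
  have "f = (\<lambda>(x, y). \<Sum>i\<le>1. \<Sum>j\<le>1 - i.
      (if i = 1 then a else if j = 1 then b else c) * x ^ i * y ^ j)"
    by (auto simp: f fun_eq_iff)
  then have "f \<in> poly_space 1"
    unfolding poly_space_def mem_Collect_eq
    by (intro exI[of _ "\<lambda>i j. if i = 1 then a else if j = 1 then b else c"])
  moreover have "f \<notin> poly_space 0"
  proof
    assume "f \<in> poly_space 0"
    then obtain d where d: "f = (\<lambda>_. d)" by (auto simp: poly_space_0)
    have "f (0, 0) = d" "f (1, 0) = d" "f (0, 1) = d" by (simp_all add: d)
    then show False using ab by (simp add: f)
  qed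
  ultimately show "linear_poly f" by (simp add: linear_poly_def)
qed

lemma linear_poly_scale: "linear_poly f \<Longrightarrow> a \<noteq> 0 \<Longrightarrow> linear_poly (\<lambda>z. a * f z)"
  unfolding linear_poly_iff
  apply clarify
  subgoal for b c d
    by (rule exI[of _ "a * b"], rule exI[of _ "a * c"], rule exI[of _ "a * d"])
       (auto simp: fun_eq_iff algebra_simps)
  done

section \<open>Division by the equation of a line, and counting zeros on it\<close>

text \<open>Induction on \<open>j\<close>: multiplying the identity by \<open>y\<close> produces
  \<open>y * P\<close>, which splits as \<open>(y - g) * P + g * P\<close>. Since \<open>g\<close>
  has degree at most 1, the new remainder \<open>g * P\<close> gains at most one degree.\<close>

lemma monom_divide:
  fixes g :: "real poly"
  assumes "degree g \<le> 1"
  shows "\<exists>q \<in> deg_less (i + j). \<exists>P. degree P \<le> i + j \<and>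
    (\<forall>x y. x ^ i * y ^ j = (y - poly g x) * q (x, y) + poly P x)"
proof (induction j)
  case 0
  show ?case
    by (intro bexI[of _ "\<lambda>_. 0"] exI[of _ "monom 1 i"])
       (auto simp: degree_monom_le poly_monom deg_less_zero)
next
  case (Suc j)
  then obtain q P where q: "q \<in> deg_less (i + j)" and P: "degree P \<le> i + j"
    and eq: "\<And>x y. x ^ i * y ^ j = (y - poly g x) * q (x, y) + poly P x" by blast
  have P_in: "(\<lambda>z. poly P (fst z)) \<in> poly_space (i + j)"
  proof -
    have "(\<lambda>z. \<Sum>k\<le>degree P. coeff P k * (case z of (x, y) \<Rightarrow> x ^ k * y ^ 0)) \<in> poly_space (i + j)"
      using P by (intro poly_space_sum poly_space_scale poly_space_monom) auto
    then show ?thesis by (simp add: poly_altdef case_prod_beta)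
  qed
  have "(\<lambda>(x, y). x ^ 0 * y ^ 1) = (snd :: real \<times> real \<Rightarrow> real)" by auto
  then have y_in: "snd \<in> poly_space 1" using poly_space_monom[of 0 1 1] by simp
  have "(\<lambda>z. snd z * q z) \<in> deg_less (1 + (i + j))"
    using deg_less_mult[OF y_in q] .
  then have "(\<lambda>z. snd z * q z + poly P (fst z)) \<in> deg_less (i + Suc j)"
    using P_in poly_space_add by simp
  moreover have "degree (g * P) \<le> i + Suc j"
    using degree_mult_le[of g P] assms P by linarith
  moreover have "x ^ i * y ^ Suc j = (y - poly g x) * (snd (x, y) * q (x, y) + poly P (fst (x, y)))
      + poly (g * P) x" for x y
    using arg_cong[OF eq[of x y], of "(*) y"] by (simp add: algebra_simps)
  ultimately show ?case by (intro bexI exI conjI allI) auto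
qed

lemma poly_space_divide:
  fixes g :: "real poly"
  assumes "p \<in> poly_space n" "degree g \<le> 1"
  shows "\<exists>q \<in> deg_less n. \<exists>P. degree P \<le> n \<and>
    (\<forall>x y. p (x, y) = (y - poly g x) * q (x, y) + poly P x)"
  using assms(1)
proof (induction rule: poly_space_induct)
  case (monom i j)
  have "deg_less (i + j) \<subseteq> deg_less n"
    using monom by (auto simp: deg_less_def poly_space_zero intro: poly_space_mono)
  moreover obtain q P where "q \<in> deg_less (i + j)" "degree P \<le> i + j"
    "\<And>x y. x ^ i * y ^ j = (y - poly g x) * q (x, y) + poly P x"
    using monom_divide[OF assms(2), of i j] by blast
  ultimately show ?case using monom by (intro bexI[of _ q] exI[of _ P]) auto
next
  case (scale a p)
  then obtain q P where "q \<in> deg_less n" "degree P \<le> n"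
    "\<And>x y. p (x, y) = (y - poly g x) * q (x, y) + poly P x" by blast
  then show ?case
    by (intro bexI[of _ "\<lambda>z. a * q z"] exI[of _ "smult a P"])
       (auto simp: algebra_simps(3) deg_less_scale mult.left_commute distrib_left)
next
  case (add p p')
  then obtain q P q' P' where "q \<in> deg_less n" "degree P \<le> n"
    "\<And>x y. p (x, y) = (y - poly g x) * q (x, y) + poly P x"
    "q' \<in> deg_less n" "degree P' \<le> n"
    "\<And>x y. p' (x, y) = (y - poly g x) * q' (x, y) + poly P' x" by blast
  then show ?case
    by (intro bexI[of _ "\<lambda>z. q z + q' z"] exI[of _ "P + P'"])
       (auto simp: algebra_simps deg_less_add degree_add_le)
qed

text \<open>On the line, which is the graph of \<open>g\<close>, \<open>p\<close> agrees with the
  univariate remainder \<open>P\<close> of degree below \<open>k\<close>. The first coordinate is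
  injective on the graph, so \<open>P\<close> has at least \<open>k\<close> roots and must
  vanish.\<close>

lemma factor_graph:
  fixes a b c :: real
  assumes b: "b \<noteq> 0" and p: "p \<in> deg_less k"
    and S: "S \<subseteq> {(x, y). a * x + b * y + c = 0}" "finite S" "k \<le> card S" "\<And>z. z \<in> S \<Longrightarrow> p z = 0"
  shows "\<exists>q \<in> deg_less (k - 1). \<forall>x y. p (x, y) = (a * x + b * y + c) * q (x, y)"
proof (cases k)
  case 0
  then show ?thesis using p by (intro bexI[of _ "\<lambda>_. 0"]) (auto simp: deg_less_def)
next
  case (Suc n)
  define g where "g = [:- c / b, - a / b:]"
  have "degree g \<le> 1" by (simp add: g_def)
  from poly_space_divide[OF _ this, of p n] p Suc obtain q P where q: "q \<in> deg_less n"
    and P: "degree P \<le> n"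
    and eq: "\<And>x y. p (x, y) = (y - poly g x) * q (x, y) + poly P x" by auto
  have g: "b * (y - poly g x) = a * x + b * y + c" for x y
    using b by (simp add: g_def field_simps)
  have on: "y = poly g x" if "(x, y) \<in> S" for x y
    using g[of y x] b S(1) that by auto
  have "inj_on fst S" by (rule inj_onI) (metis on prod.collapse)
  then have "card (fst ` S) = card S" by (rule card_image)
  moreover have "fst ` S \<subseteq> {x. poly P x = 0}"
  proof clarsimp
    fix x y assume xy: "(x, y) \<in> S"
    show "poly P x = 0" using eq[of x y] S(4)[OF xy] on[OF xy] by simp
  qed
  ultimately have "P \<noteq> 0 \<Longrightarrow> card S \<le> degree P"
    by (metis card_mono card_poly_roots_bound le_trans poly_roots_finite)
  then have "P = 0" using P S(3) Suc by auto
  then have "p (x, y) = (a * x + b * y + c) * ((1 / b) * q (x, y))" for x y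
    using eq[of x y] g[of y x, symmetric] b by simp
  moreover have "(\<lambda>z. (1 / b) * q z) \<in> deg_less (k - 1)" using q Suc by (simp only: deg_less_scale diff_Suc_1)
  ultimately show ?thesis by (intro bexI[of _ "\<lambda>z. (1 / b) * q z"]) auto
qed

text \<open>The main tool of the development. A line that is not vertical is a graph over the first
  axis; a vertical one becomes a graph after swapping the coordinates.\<close>

lemma factor_line:
  assumes f: "linear_poly f" and p: "p \<in> deg_less k"
    and S: "finite S" "k \<le> card S" "\<And>z. z \<in> S \<Longrightarrow> f z = 0" "\<And>z. z \<in> S \<Longrightarrow> p z = 0"
  obtains q where "q \<in> deg_less (k - 1)" "p = (\<lambda>z. f z * q z)"
proof -
  obtain a b c where ab: "a \<noteq> 0 \<or> b \<noteq> 0" and fe: "f = (\<lambda>(x, y). a * x + b * y + c)"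
    using f unfolding linear_poly_iff by blast
  show ?thesis
  proof (cases "b = 0")
    case False
    from factor_graph[OF this p _ S(1,2,4), of a c] S(3) obtain q where
      "q \<in> deg_less (k - 1)" "\<And>x y. p (x, y) = (a * x + b * y + c) * q (x, y)"
      by (auto simp: fe)
    then show ?thesis by (intro that[of q]) (auto simp: fe)
  next
    case True
    then have a: "a \<noteq> 0" using ab by simp
    have 1: "prod.swap ` S \<subseteq> {(x, y). b * x + a * y + c = 0}"
      using S(3) by (auto simp: fe algebra_simps)
    have 2: "k \<le> card (prod.swap ` S)" using S(2) by (simp add: card_image)
    from factor_graph[OF a deg_less_swap[OF p] 1 _ 2] S(1,4) obtain q where
      q: "q \<in> deg_less (k - 1)" "\<And>x y. (p \<circ> prod.swap) (x, y) = (b * x + a * y + c) * q (x, y)"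
      by auto
    have "p (x, y) = f (x, y) * (q \<circ> prod.swap) (x, y)" for x y
      using q(2)[of y x] by (simp add: fe algebra_simps)
    then have "p = (\<lambda>z. f z * (q \<circ> prod.swap) z)" by (auto simp: fun_eq_iff)
    with deg_less_swap[OF q(1)] show ?thesis by (intro that[of "q \<circ> prod.swap"]) auto
  qed
qed

lemma poly_space_restrict:
  assumes "p \<in> poly_space n"
  shows "\<exists>P. \<forall>t. p (x + t * u, y + t * v) = poly P t"
  using assms
proof (induction rule: poly_space_induct)
  case (monom i j)
  show ?case by (intro exI[of _ "[:x, u:] ^ i * [:y, v:] ^ j"]) (simp add: poly_power)
next
  case (scale a q)
  then obtain P where "\<And>t. q (x + t * u, y + t * v) = poly P t" by blast
  then show ?case by (intro exI[of _ "smult a P"]) simp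
next
  case (add q r)
  then obtain P Q where "\<And>t. q (x + t * u, y + t * v) = poly P t"
    "\<And>t. r (x + t * u, y + t * v) = poly Q t" by blast
  then show ?case by (intro exI[of _ "P + Q"]) simp
qed

text \<open>Along the normal direction \<open>(a, b)\<close> through \<open>z\<close>,
  \<open>f\<close> becomes a univariate polynomial with slope \<open>a * a + b * b\<close>, hence
  nonzero. So the restriction of \<open>q\<close> vanishes, and its value at parameter 0 is
  \<open>q z\<close>.\<close>

lemma poly_space_cancel:
  assumes f: "linear_poly f" and q: "q \<in> poly_space n" and 0: "\<And>z. f z * q z = 0"
  shows "q = (\<lambda>_. 0)"
proof
  fix z :: "real \<times> real"
  obtain x y where z: "z = (x, y)" by (cases z)
  obtain a b c where ab: "a \<noteq> 0 \<or> b \<noteq> 0" and fe: "f = (\<lambda>(x, y). a * x + b * y + c)"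
    using f unfolding linear_poly_iff by blast
  obtain P where P: "\<And>t. q (x + t * a, y + t * b) = poly P t"
    using poly_space_restrict[OF q] by blast
  have "a * a + b * b \<noteq> 0" using ab by (simp add: sum_squares_eq_zero_iff)
  moreover have "poly [:f z, a * a + b * b:] t = f (x + t * a, y + t * b)" for t
    by (simp add: fe z algebra_simps)
  ultimately have "[:f z, a * a + b * b:] \<noteq> 0" "\<And>t. poly ([:f z, a * a + b * b:] * P) t = 0"
    using 0 by (simp, metis P poly_mult)
  then have "P = 0" by (metis mult_eq_0_iff poly_all_0_iff_0)
  then show "q z = 0" using P[of 0] by (simp add: z)
qed

section \<open>Lines and poised sets\<close>

lemma linear_poly_in: "linear_poly f \<Longrightarrow> f \<in> poly_space 1"
  by (simp add: linear_poly_def)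

text \<open>Two common zeros permit one division by \<open>f\<close>; the quotient lies in
  \<open>deg_less 1\<close> and so is constant.\<close>

lemma linear_poly_proportional:
  assumes "linear_poly f" "linear_poly g" "P \<noteq> Q" "f P = 0" "f Q = 0" "g P = 0" "g Q = 0"
  obtains c where "c \<noteq> 0" "g = (\<lambda>z. c * f z)"
proof -
  have "g \<in> deg_less 2" using linear_poly_in[OF assms(2)] by (simp add: numeral_2_eq_2)
  then obtain q where q: "q \<in> deg_less 1" "g = (\<lambda>z. f z * q z)"
    using factor_line[OF assms(1), of g 2 "{P, Q}"] assms(3-) by auto
  then obtain c where c: "q = (\<lambda>_. c)" by (auto simp: poly_space_0)
  have "c \<noteq> 0" using assms(2) q(2) c poly_space_zero by (auto simp: linear_poly_def)
  with c q(2) show ?thesis by (intro that[of c]) auto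
qed

lemma is_lineE:
  assumes "is_line l"
  obtains f where "linear_poly f" "l = {z. f z = 0}" "defines_line f l"
  using assms by (auto simp: is_line_def defines_line_def)

lemma is_line_zeros: "linear_poly f \<Longrightarrow> is_line {z. f z = 0}"
  by (auto simp: is_line_def defines_line_def)

lemma line_eq:
  assumes "is_line l" "is_line m" "P \<in> l" "P \<in> m" "Q \<in> l" "Q \<in> m" "P \<noteq> Q"
  shows "l = m"
proof -
  from assms obtain f g where f: "linear_poly f" "l = {z. f z = 0}"
    and g: "linear_poly g" "m = {z. g z = 0}" by (metis is_lineE)
  obtain c where "c \<noteq> 0" "g = (\<lambda>z. c * f z)"
    using linear_poly_proportional[OF f(1) g(1) assms(7)] assms f(2) g(2) by auto
  then show ?thesis using f g by auto
qed

section \<open>Interpolation and fundamental polynomials\<close>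

lemma poised_zero:
  assumes "poised n X" "p \<in> poly_space n" "\<And>A. A \<in> X \<Longrightarrow> p A = 0"
  shows "p = (\<lambda>_. 0)"
proof -
  have "\<exists>!p. p \<in> poly_space n \<and> (\<forall>A\<in>X. p A = 0)"
    using assms(1) unfolding poised_def by (elim conjE allE)
  then show ?thesis using assms(2,3) poly_space_zero[of n] by blast
qed

lemma fundamental_poly:
  assumes "poised n X" "A \<in> X"
  shows "fundamental_poly n X A \<in> poly_space n" "fundamental_poly n X A A = 1"
    and "\<And>B. B \<in> X \<Longrightarrow> B \<noteq> A \<Longrightarrow> fundamental_poly n X A B = 0"
proof -
  have "\<exists>!p. p \<in> poly_space n \<and> (\<forall>B\<in>X. p B = (if B = A then 1 else 0))"
    using assms(1) unfolding poised_def by (elim conjE allE)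
  moreover have "(p \<in> poly_space n \<and> (\<forall>B\<in>X. p B = (if B = A then 1 else 0))) \<longleftrightarrow>
      (p \<in> poly_space n \<and> p A = 1 \<and> (\<forall>B\<in>X - {A}. p B = 0))" for p :: "real \<times> real \<Rightarrow> real"
    using assms(2) by auto
  ultimately have "\<exists>!p. p \<in> poly_space n \<and> p A = 1 \<and> (\<forall>B\<in>X - {A}. p B = 0)" by simp
  from theI'[OF this] show "fundamental_poly n X A \<in> poly_space n" "fundamental_poly n X A A = 1"
    "\<And>B. B \<in> X \<Longrightarrow> B \<noteq> A \<Longrightarrow> fundamental_poly n X A B = 0"
    unfolding fundamental_poly_def by auto
qed

lemma fundamental_poly_unique:
  assumes "poised n X" "A \<in> X" "p \<in> poly_space n" "p A = 1" "\<And>B. B \<in> X \<Longrightarrow> B \<noteq> A \<Longrightarrow> p B = 0"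
  shows "fundamental_poly n X A = p"
proof -
  let ?d = "\<lambda>z. p z + (-1) * fundamental_poly n X A z"
  have "?d = (\<lambda>_. 0)"
  proof (rule poised_zero[OF assms(1)])
    show "?d \<in> poly_space n"
      using fundamental_poly[OF assms(1,2)] assms(3) by (intro poly_space_add poly_space_scale)
    show "?d B = 0" if "B \<in> X" for B
      using fundamental_poly[OF assms(1,2)] assms(4,5) that by (cases "B = A") auto
  qed
  then show ?thesis by (auto simp: fun_eq_iff)
qed

lemma poised_0_singleton:
  assumes "poised 0 X"
  shows "\<exists>A. X = {A}"
proof -
  have "X \<noteq> {}"
  proof
    assume "X = {}"
    then have "(\<lambda>_ :: real \<times> real. 1 :: real) = (\<lambda>_. 0)"
      by (intro poised_zero[OF assms] poly_space_const) auto
    from fun_cong[OF this] show False by simp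
  qed
  moreover have "A = B" if "A \<in> X" "B \<in> X" for A B
  proof (rule ccontr)
    assume "A \<noteq> B"
    then have "fundamental_poly 0 X A A = 1" "fundamental_poly 0 X A B = 0"
      using fundamental_poly[OF assms that(1)] that by auto
    moreover obtain c where "fundamental_poly 0 X A = (\<lambda>_. c)"
      using fundamental_poly(1)[OF assms \<open>A \<in> X\<close>] by (auto simp: poly_space_0)
    ultimately show False by simp
  qed
  ultimately show ?thesis by blast
qed

lemma poised_finite: "poised n X \<Longrightarrow> finite X"
  by (simp add: poised_def)

text \<open>With \<open>n + 2\<close> nodes on \<open>l\<close>, the fundamental polynomial of one
  of them would have \<open>n + 1\<close> zeros on \<open>l\<close>, hence be divisible by the
  equation of \<open>l\<close> and vanish at its own node.\<close>

lemma card_line_le: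
  assumes "poised n X" "is_line l"
  shows "card (l \<inter> X) \<le> n + 1"
proof (rule ccontr)
  assume less: "\<not> ?thesis"
  then have "l \<inter> X \<noteq> {}" by auto
  then obtain A where A: "A \<in> l" "A \<in> X" by blast
  obtain f where f: "linear_poly f" "l = {z. f z = 0}" using assms(2) by (rule is_lineE)
  have "Suc n \<le> card (l \<inter> X - {A})" using A less by simp
  moreover have "f z = 0" "fundamental_poly n X A z = 0" if "z \<in> l \<inter> X - {A}" for z
    using fundamental_poly(3)[OF assms(1) A(2), of z] f(2) that by simp_all
  ultimately obtain q where q: "fundamental_poly n X A = (\<lambda>z. f z * q z)"
    using factor_line[OF f(1), of "fundamental_poly n X A" "Suc n" "l \<inter> X - {A}"]
      fundamental_poly(1)[OF assms(1) A(2)] poised_finite[OF assms(1)] by (metis deg_less_Suc finite_Diff finite_Int)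
  show False using fundamental_poly(2)[OF assms(1) A(2)] A f(2) fun_cong[OF q, of A] by simp
qed

section \<open>Maximal lines and their removal\<close>

lemma maximal_lineD:
  assumes "maximal_line n X l"
  shows "is_line l" "finite (l \<inter> X)" "card (l \<inter> X) = n + 1"
  using assms by (auto simp: maximal_line_def node_line_def)

lemma maximal_lineI:
  assumes "poised n X" "is_line l" "n + 1 \<le> card (l \<inter> X)"
  shows "maximal_line n X l"
  using assms card_line_le[OF assms(1,2)] poised_finite[OF assms(1)]
  by (simp add: maximal_line_def node_line_def)

text \<open>Interpolating \<open>v\<close> on \<open>X - l\<close> amounts to interpolating
  \<open>f * v\<close> on \<open>X\<close> one degree higher: that interpolant vanishes at the
  \<open>n + 2\<close> nodes of \<open>l\<close>, so \<open>f\<close> divides it. Uniqueness follows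
  by multiplying a difference by \<open>f\<close> and cancelling.\<close>

lemma poised_remove:
  assumes X: "poised (Suc n) X" and l: "maximal_line (Suc n) X l"
  shows "poised n (X - l)"
proof -
  obtain f where f: "linear_poly f" "l = {z. f z = 0}" using maximal_lineD(1)[OF l] by (rule is_lineE)
  have "\<exists>!q. q \<in> poly_space n \<and> (\<forall>A\<in>X - l. q A = v A)" for v :: "real \<times> real \<Rightarrow> real"
  proof (rule ex_ex1I)
    obtain p where p: "p \<in> poly_space (Suc n)" "\<And>A. A \<in> X \<Longrightarrow> p A = f A * v A"
    proof -
      have "\<exists>!p. p \<in> poly_space (Suc n) \<and> (\<forall>A\<in>X. p A = f A * v A)"
        using X unfolding poised_def by (elim conjE allE)
      then show ?thesis using that by blast
    qed
    have zero: "f z = 0" "p z = 0" if "z \<in> l \<inter> X" for z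
      using p(2)[of z] f(2) that by simp_all
    obtain q where q: "q \<in> deg_less (Suc n)" "p = (\<lambda>z. f z * q z)"
    proof (rule factor_line[OF f(1) _ maximal_lineD(2)[OF l] _ zero])
      show "p \<in> deg_less (Suc (Suc n))" "Suc (Suc n) \<le> card (l \<inter> X)"
        using p(1) maximal_lineD(3)[OF l] by simp_all
    qed simp_all
    show "\<exists>q. q \<in> poly_space n \<and> (\<forall>A\<in>X - l. q A = v A)"
    proof (intro exI[of _ q] conjI ballI)
      show "q \<in> poly_space n" using q(1) by simp
      fix A assume A: "A \<in> X - l"
      then have "f A * q A = f A * v A" using p(2)[of A] fun_cong[OF q(2), of A] by simp
      then show "q A = v A" using A f(2) by simp
    qed
  next
    fix q q' :: "real \<times> real \<Rightarrow> real"
    assume q: "q \<in> poly_space n \<and> (\<forall>A\<in>X - l. q A = v A)"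
      and q': "q' \<in> poly_space n \<and> (\<forall>A\<in>X - l. q' A = v A)"
    let ?d = "\<lambda>z. q z + (-1) * q' z"
    have d: "?d \<in> poly_space n" using poly_space_add[OF conjunct1[OF q] poly_space_scale[OF conjunct1[OF q']]] .
    have "(\<lambda>z. f z * ?d z) = (\<lambda>_. 0)"
    proof (rule poised_zero[OF X])
      show "(\<lambda>z. f z * ?d z) \<in> poly_space (Suc n)"
        using poly_space_mult[OF linear_poly_in[OF f(1)] d] by simp
      show "f A * ?d A = 0" if "A \<in> X" for A
        using q q' f(2) that by (cases "A \<in> l") simp_all
    qed
    then have "?d = (\<lambda>_. 0)" by (intro poly_space_cancel[OF f(1) d]) (erule fun_cong)
    then show "q = q'" by (auto simp: fun_eq_iff)
  qed
  then show ?thesis using poised_finite[OF X] by (simp add: poised_def)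
qed

text \<open>If \<open>m\<close> shared no node with \<open>l\<close>, it would keep all its nodes in
  \<open>X - l\<close>, one more than the lower degree allows.\<close>

lemma maximal_meet:
  assumes X: "poised n X" and l: "maximal_line n X l" and m: "maximal_line n X m" and "l \<noteq> m"
  obtains P where "P \<in> X" "P \<in> l" "P \<in> m"
proof (cases n)
  case 0
  then obtain A where A: "X = {A}" using X poised_0_singleton by blast
  have "A \<in> l" using maximal_lineD[OF l] A by (cases "A \<in> l") auto
  moreover have "A \<in> m" using maximal_lineD[OF m] A by (cases "A \<in> m") auto
  ultimately show ?thesis using that A by auto
next
  case (Suc k)
  have "card (m \<inter> (X - l)) \<le> k + 1"
    using card_line_le poised_remove X l Suc maximal_lineD(1)[OF m] by blast
  then have "m \<inter> (X - l) \<noteq> m \<inter> X" using maximal_lineD(3)[OF m] Suc by auto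
  then show ?thesis using that by blast
qed

lemma card_inter_remove:
  assumes "is_line l" "is_line m" "l \<noteq> m" "P \<in> X" "P \<in> l" "P \<in> m" "finite (m \<inter> X)"
  shows "card (m \<inter> (X - l)) = card (m \<inter> X) - 1"
proof -
  have "m \<inter> (X - l) = m \<inter> X - {P}" using assms line_eq by blast
  then show ?thesis using assms by simp
qed

lemma maximal_remove:
  assumes X: "poised (Suc n) X" and l: "maximal_line (Suc n) X l" and m: "maximal_line (Suc n) X m"
    and "l \<noteq> m"
  shows "maximal_line n (X - l) m"
proof -
  obtain P where "P \<in> X" "P \<in> l" "P \<in> m" using maximal_meet[OF assms] .
  then have "card (m \<inter> (X - l)) = n + 1"
    using card_inter_remove[of l m P X] maximal_lineD[OF l] maximal_lineD[OF m] \<open>l \<noteq> m\<close> by simp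
  then show ?thesis
    using maximal_lineI[OF poised_remove[OF X l] maximal_lineD(1)[OF m]] by simp
qed

text \<open>After removing \<open>l\<close>, the lines \<open>m\<close> and \<open>r\<close> still
  share a node. It lies off \<open>l\<close>, so together with \<open>P\<close> they would have two
  common points.\<close>

lemma not_concurrent:
  assumes X: "poised (Suc n) X" and "maximal_line (Suc n) X l" "maximal_line (Suc n) X m"
    "maximal_line (Suc n) X r" "l \<noteq> m" "l \<noteq> r" "m \<noteq> r" "P \<in> l" "P \<in> m" "P \<in> r"
  shows False
proof -
  obtain Q where "Q \<in> X - l" "Q \<in> m" "Q \<in> r"
    using maximal_meet[OF poised_remove[OF X assms(2)] maximal_remove[OF X assms(2,3)]
        maximal_remove[OF X assms(2,4)]] assms(5-7) by metis
  then show False using line_eq[of m r P Q] assms maximal_lineD(1) by blast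
qed

section \<open>Fundamental polynomials as products of lines\<close>

lemma prod_linear_in:
  assumes "finite I" "\<And>i. i \<in> I \<Longrightarrow> linear_poly (L i)"
  shows "(\<lambda>z. \<Prod>i\<in>I. L i z) \<in> poly_space (card I)"
  using assms
proof (induction I)
  case empty
  show ?case by (simp add: poly_space_const)
next
  case (insert j I)
  then have "L j \<in> poly_space 1" "(\<lambda>z. \<Prod>i\<in>I. L i z) \<in> poly_space (card I)"
    by (simp_all add: linear_poly_def)
  from poly_space_mult[OF this] insert.hyps show ?case by simp
qed

text \<open>Records the zero pattern of the factors and leaves out their scaling. For a node of a
  poised set, the product of the \<open>L i\<close> is a nonzero multiple of its fundamental
  polynomial.\<close>

definition node_factors :: "nat \<Rightarrow> (real \<times> real) set \<Rightarrow> real \<times> real \<Rightarrow> (nat \<Rightarrow> real \<times> real \<Rightarrow> real) \<Rightarrow> bool" where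
  "node_factors n X A L \<longleftrightarrow> (\<forall>i<n. linear_poly (L i)) \<and> (\<forall>i<n. L i A \<noteq> 0) \<and>
     (\<forall>B\<in>X - {A}. \<exists>i<n. L i B = 0)"

lemma GC_set_iff: "GC_set n X \<longleftrightarrow> poised n X \<and> (\<forall>A\<in>X. \<exists>L. node_factors n X A L)"
proof (cases "poised n X")
  case X: True
  have "(\<exists>L. (\<forall>i<n. linear_poly (L i)) \<and> fundamental_poly n X A = (\<lambda>z. \<Prod>i<n. L i z)) \<longleftrightarrow>
      (\<exists>L. node_factors n X A L)" if A: "A \<in> X" for A
  proof
    assume "\<exists>L. (\<forall>i<n. linear_poly (L i)) \<and> fundamental_poly n X A = (\<lambda>z. \<Prod>i<n. L i z)"
    then obtain L where L: "\<forall>i<n. linear_poly (L i)" "fundamental_poly n X A = (\<lambda>z. \<Prod>i<n. L i z)"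
      by blast
    have "(\<Prod>i<n. L i A) \<noteq> 0" using fundamental_poly(2)[OF X A] L(2) by simp
    moreover have "(\<Prod>i<n. L i B) = 0" if "B \<in> X - {A}" for B
      using fundamental_poly(3)[OF X A, of B] that L(2) by auto
    ultimately have "node_factors n X A L"
      using L(1) by (fastforce simp: node_factors_def)
    then show "\<exists>L. node_factors n X A L" by blast
  next
    assume "\<exists>L. node_factors n X A L"
    then obtain L where L: "node_factors n X A L" by blast
    define c where "c = (\<Prod>i<n. L i A)"
    have "c \<noteq> 0" using L by (auto simp: c_def node_factors_def)
    \<comment> \<open>Factor 0 absorbs the normalising constant. For \<open>n = 0\<close> both
      products are empty and \<open>c = 1\<close>.\<close>
    define L' where "L' i = (\<lambda>z. (if i = 0 then 1 / c else 1) * L i z)" for i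
    have lin: "linear_poly (L' i)" if "i < n" for i
      using L that \<open>c \<noteq> 0\<close> unfolding L'_def node_factors_def by (intro linear_poly_scale) auto
    have prod: "(\<Prod>i<n. L' i z) = (1 / c) * (\<Prod>i<n. L i z)" for z
    proof (cases "n = 0")
      case False
      then have "(\<Prod>i<n. if i = 0 then 1 / c else 1 :: real) = 1 / c" by (simp add: prod.delta)
      then show ?thesis by (simp add: L'_def prod.distrib)
    qed (simp add: c_def)
    have "fundamental_poly n X A = (\<lambda>z. \<Prod>i<n. L' i z)"
    proof (rule fundamental_poly_unique[OF X A])
      show "(\<lambda>z. \<Prod>i<n. L' i z) \<in> poly_space n" using prod_linear_in[of "{..<n}" L'] lin by simp
      show "(\<Prod>i<n. L' i A) = 1" using \<open>c \<noteq> 0\<close> by (simp add: prod flip: c_def)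
      show "(\<Prod>i<n. L' i B) = 0" if B: "B \<in> X" "B \<noteq> A" for B
      proof -
        obtain i where "i < n" "L i B = 0" using L B unfolding node_factors_def by blast
        then have "(\<Prod>i<n. L i B) = 0" by (intro prod_zero) auto
        then show ?thesis by (simp only: prod mult_zero_right)
      qed
    qed
    with lin show "\<exists>L. (\<forall>i<n. linear_poly (L i)) \<and> fundamental_poly n X A = (\<lambda>z. \<Prod>i<n. L i z)"
      by blast
  qed
  then show ?thesis by (simp add: GC_set_def)
qed (simp add: GC_set_def)

lemma GC_poised: "GC_set n X \<Longrightarrow> poised n X"
  by (simp add: GC_set_def)

text \<open>A line other than \<open>m\<close> contains at most one point of \<open>m\<close>, so
  choosing for each point of \<open>S\<close> a line through it is injective. If there are as many
  points as lines, the choice is also onto.\<close>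

lemma pigeonhole_lines:
  assumes m: "is_line m" and S: "finite S" "S \<subseteq> m"
    and L: "\<And>i. i < (n :: nat) \<Longrightarrow> linear_poly (L i)"
    and cover: "\<And>P. P \<in> S \<Longrightarrow> \<exists>i<n. L i P = 0"
    and no: "\<And>i. i < n \<Longrightarrow> {z. L i z = 0} \<noteq> m"
  shows "card S \<le> n" "\<And>i. card S = n \<Longrightarrow> i < n \<Longrightarrow> \<exists>P\<in>S. L i P = 0"
proof -
  from cover obtain g where g: "\<And>P. P \<in> S \<Longrightarrow> g P < n \<and> L (g P) P = 0" by metis
  have inj: "inj_on g S"
  proof (rule inj_onI, rule ccontr)
    fix P Q assume PQ: "P \<in> S" "Q \<in> S" "g P = g Q" "P \<noteq> Q"
    then have "L (g P) P = 0" "L (g P) Q = 0" "g P < n" using g by metis+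
    then have "{z. L (g P) z = 0} = m"
      using PQ S(2) by (intro line_eq[OF is_line_zeros[OF L] m, where P = P and Q = Q]) auto
    then show False using no g PQ by blast
  qed
  have img: "g ` S \<subseteq> {..<n}" using g by auto
  show "card S \<le> n" using card_mono[OF _ img] card_image[OF inj] by simp
  show "\<exists>P\<in>S. L i P = 0" if "card S = n" "i < n" for i
  proof -
    have "g ` S = {..<n}" using that(1) card_image[OF inj] by (intro card_seteq[OF _ img]) simp_all
    then have "i \<in> g ` S" using that(2) by simp
    then show ?thesis using g by blast
  qed
qed

text \<open>The \<open>n + 1\<close> factors of a node off \<open>l\<close> cover the
  \<open>n + 2\<close> nodes of \<open>l\<close>, so by the pigeonhole principle one of them defines
  \<open>l\<close>. The others serve for \<open>X - l\<close>.\<close>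

lemma GC_remove:
  assumes X: "GC_set (Suc n) X" and l: "maximal_line (Suc n) X l"
  shows "GC_set n (X - l)"
  unfolding GC_set_iff
proof (intro conjI ballI)
  note l' = maximal_lineD[OF l]
  show "poised n (X - l)" using poised_remove[OF GC_poised[OF X] l] .
  fix A assume A: "A \<in> X - l"
  then obtain L where L: "node_factors (Suc n) X A L" using X by (auto simp: GC_set_iff)
  have "\<exists>j<Suc n. {z. L j z = 0} = l"
  proof (rule ccontr)
    assume "\<not> ?thesis"
    then have "card (l \<inter> X) \<le> Suc n"
      using L A by (intro pigeonhole_lines(1)[OF l'(1,2), where L = L]) (auto simp: node_factors_def)
    then show False using l'(3) by simp
  qed
  then obtain j where j: "j < Suc n" "{z. L j z = 0} = l" by blast
  \<comment> \<open>Enumerates the indices below \<open>Suc n\<close> other than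
    \<open>j\<close>.\<close>
  define s where "s i = (if i < j then i else Suc i)" for i
  have "node_factors n (X - l) A (\<lambda>i. L (s i))"
    unfolding node_factors_def
  proof (intro conjI allI impI ballI)
    fix i assume "i < n"
    then have "s i < Suc n" by (simp add: s_def)
    then show "linear_poly (L (s i))" "L (s i) A \<noteq> 0" using L by (auto simp: node_factors_def)
  next
    fix B assume B: "B \<in> X - l - {A}"
    then obtain i where i: "i < Suc n" "L i B = 0" using L unfolding node_factors_def by blast
    then have "i \<noteq> j" using B j(2) by auto
    then have "i = s (if i < j then i else i - 1)" by (auto simp: s_def)
    with i j(1) \<open>i \<noteq> j\<close> show "\<exists>i<n. L (s i) B = 0"
      by (intro exI[of _ "if i < j then i else i - 1"]) auto
  qed
  then show "\<exists>L. node_factors n (X - l) A L" by blast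
qed

section \<open>Counting nodes under the Gasca-Maeztu assumption\<close>

definition GM_upto :: "nat \<Rightarrow> bool" where
  "GM_upto n \<longleftrightarrow> (\<forall>k. 1 \<le> k \<and> k \<le> n \<longrightarrow> Gasca_Maeztu k)"

lemma GM_upto_mono: "GM_upto n \<Longrightarrow> m \<le> n \<Longrightarrow> GM_upto m"
  by (auto simp: GM_upto_def)

lemma GM_upto_maximal:
  assumes "GM_upto n" "GC_set n X" "1 \<le> n"
  obtains l where "maximal_line n X l"
  using assms by (auto simp: GM_upto_def Gasca_Maeztu_def)

text \<open>Maximal lines are peeled off one at a time; in degree \<open>Suc n\<close> this takes
  away \<open>n + 2\<close> nodes.\<close>

lemma GC_card:
  assumes "GM_upto n" "GC_set n X"
  shows "card X = (n + 2) choose 2"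
  using assms
proof (induction n arbitrary: X)
  case 0
  then obtain A where "X = {A}" using poised_0_singleton GC_poised by blast
  then show ?case by (simp add: numeral_2_eq_2)
next
  case (Suc n)
  then obtain l where l: "maximal_line (Suc n) X l" using GM_upto_maximal[of "Suc n" X] by auto
  have "card (X - l) = (n + 2) choose 2"
    using Suc GM_upto_mono GC_remove[OF Suc.prems(2) l] by simp
  moreover have "card X = card (l \<inter> X) + card (X - l)"
    using poised_finite[OF GC_poised[OF Suc.prems(2)]] by (metis card_Int_Diff inf_commute)
  ultimately show ?case using maximal_lineD(3)[OF l] by (simp add: numeral_2_eq_2)
qed

section \<open>Lines used by the nodes of a maximal line\<close>

text \<open>The other \<open>n\<close> nodes of \<open>l\<close> are covered by \<open>n\<close>
  lines, none of which is \<open>l\<close> because they avoid \<open>A\<close>. So each line takes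
  exactly one of these nodes.\<close>

lemma node_factors_meet_maximal:
  assumes l: "maximal_line n X l" and A: "A \<in> l \<inter> X"
    and L: "node_factors n X A L" and i: "i < n"
  shows "\<exists>B\<in>l \<inter> X. B \<noteq> A \<and> L i B = 0"
proof -
  note l' = maximal_lineD[OF l]
  have "\<exists>B\<in>l \<inter> X - {A}. L i B = 0"
  proof (rule pigeonhole_lines(2)[OF l'(1) _ _ _ _ _ _ i])
    show "\<exists>i<n. L i B = 0" if "B \<in> l \<inter> X - {A}" for B
      using L that by (auto simp: node_factors_def)
    show "{z. L i z = 0} \<noteq> l" if "i < n" for i
      using L A that by (auto simp: node_factors_def)
    show "card (l \<inter> X - {A}) = n" using l' A by simp
  qed (use l' L in \<open>auto simp: node_factors_def\<close>)
  then show ?thesis by blast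
qed

text \<open>The \<open>k + 1\<close> nodes of \<open>m\<close> are covered by \<open>k + 1\<close>
  lines. None of these is \<open>m\<close>, since each of them meets \<open>l\<close> in a node and
  \<open>m\<close> does not.\<close>

lemma node_factors_meet_submaximal:
  assumes l: "maximal_line (Suc k) X l" and m: "maximal_line k (X - l) m" and disj: "m \<inter> l \<inter> X = {}"
    and A: "A \<in> l \<inter> X" and L: "node_factors (Suc k) X A L" and i: "i < Suc k"
  shows "\<exists>B\<in>m \<inter> (X - l). L i B = 0"
proof -
  note m' = maximal_lineD[OF m]
  show ?thesis
  proof (rule pigeonhole_lines(2)[OF m'(1) _ _ _ _ _ _ i])
    show "\<exists>i<Suc k. L i B = 0" if "B \<in> m \<inter> (X - l)" for B
    proof -
      have "B \<in> X - {A}" using that A by blast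
      then show ?thesis using L unfolding node_factors_def by blast
    qed
    show "{z. L i z = 0} \<noteq> m" if "i < Suc k" for i
      using node_factors_meet_maximal[OF l A L that] disj by blast
    show "card (m \<inter> (X - l)) = Suc k" using m' by simp
  qed (use m' L in \<open>auto simp: node_factors_def\<close>)
qed

text \<open>Here \<open>q\<close> is the product of the factors other than
  \<open>L i\<close>.\<close>

lemma node_factors_split:
  assumes L: "node_factors (Suc k) X A L" and i: "i < Suc k"
  obtains q where "q \<in> poly_space k" "q A \<noteq> 0" "\<And>B. B \<in> X \<Longrightarrow> B \<noteq> A \<Longrightarrow> L i B \<noteq> 0 \<Longrightarrow> q B = 0"
proof -
  let ?I = "{..<Suc k} - {i}"
  have lin: "linear_poly (L j)" if "j \<in> ?I" for j using L that by (simp add: node_factors_def)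
  have "card ?I = k" using i by simp
  then have "(\<lambda>z. \<Prod>j\<in>?I. L j z) \<in> poly_space k" using prod_linear_in[of ?I L] lin by simp
  moreover have "(\<Prod>j\<in>?I. L j A) \<noteq> 0" using L by (auto simp: node_factors_def)
  moreover have "(\<Prod>j\<in>?I. L j B) = 0" if B: "B \<in> X" "B \<noteq> A" "L i B \<noteq> 0" for B
  proof -
    obtain j where "j < Suc k" "L j B = 0" using L B unfolding node_factors_def by blast
    then show ?thesis using B(3) by (intro prod_zero) auto
  qed
  ultimately show ?thesis by (rule that)
qed

text \<open>If \<open>A\<close> and \<open>B\<close> both used the line \<open>h = 0\<close>, then a linear combination of the cofactors that
  vanishes at \<open>P\<close> would be divisible by \<open>m1\<close>, \<open>m2\<close> and \<open>l\<close>, so would vanish at \<open>A\<close> and \<open>B\<close>.\<close>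

lemma shared_factor_contradiction:
  assumes l: "maximal_line (Suc k) X l"
    and m1: "maximal_line k (X - l) m1" and m2: "maximal_line k (X - l) m2" and "m1 \<noteq> m2"
    and d1: "m1 \<inter> l \<inter> X = {}" and d2: "m2 \<inter> l \<inter> X = {}"
    and P: "P \<in> m1" "P \<in> m2" "P \<in> X"
    and A: "A \<in> l \<inter> X" and B: "B \<in> l \<inter> X" and "A \<noteq> B"
    and h: "linear_poly h" "h A \<noteq> 0" "h B \<noteq> 0" "h P = 0" "h R = 0" and R: "R \<in> l \<inter> X"
    and qA: "qA \<in> poly_space k" "qA A \<noteq> 0" "\<And>C. C \<in> X \<Longrightarrow> C \<noteq> A \<Longrightarrow> h C \<noteq> 0 \<Longrightarrow> qA C = 0"
    and qB: "qB \<in> poly_space k" "qB B \<noteq> 0" "\<And>C. C \<in> X \<Longrightarrow> C \<noteq> B \<Longrightarrow> h C \<noteq> 0 \<Longrightarrow> qB C = 0"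
  shows False
proof -
  obtain f where f: "linear_poly f" "l = {z. f z = 0}" using maximal_lineD(1)[OF l] by (rule is_lineE)
  obtain f1 where f1: "linear_poly f1" "m1 = {z. f1 z = 0}" using maximal_lineD(1)[OF m1] by (rule is_lineE)
  obtain f2 where f2: "linear_poly f2" "m2 = {z. f2 z = 0}" using maximal_lineD(1)[OF m2] by (rule is_lineE)
  define M where "M = {z. h z = 0}"
  have M: "is_line M" "P \<in> M" "R \<in> M" "A \<notin> M" "B \<notin> M"
    using h by (auto simp: M_def is_line_zeros)
  have Mm1: "C \<notin> M" if "C \<in> m1" "C \<noteq> P" for C
    using line_eq[OF M(1) maximal_lineD(1)[OF m1], of P C] M P that d1 R by blast
  have Mm2: "C \<notin> M" if "C \<in> m2" "C \<noteq> P" for C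
    using line_eq[OF M(1) maximal_lineD(1)[OF m2], of P C] M P that d2 R by blast
  have Ml: "C \<notin> M" if "C \<in> l" "C \<noteq> R" for C
    using line_eq[OF M(1) maximal_lineD(1)[OF l], of R C] M A R that by blast
  have m12: "C \<notin> m2" if "C \<in> m1" "C \<noteq> P" for C
    using line_eq[OF maximal_lineD(1)[OF m1] maximal_lineD(1)[OF m2], of P C] P that \<open>m1 \<noteq> m2\<close> by blast
  \<comment> \<open>A single linear condition on two coefficients has a nontrivial solution.\<close>
  obtain a b where ab: "a \<noteq> 0 \<or> b \<noteq> 0" "a * qA P + b * qB P = (0 :: real)"
  proof (cases "qA P = 0")
    case True
    then show ?thesis by (intro that[of 1 0]) auto
  next
    case False
    then show ?thesis by (intro that[of "qB P" "- qA P"]) auto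
  qed
  define D where "D z = a * qA z + b * qB z" for z
  have D_in: "D \<in> deg_less (Suc k)"
    using poly_space_add[OF poly_space_scale[OF qA(1)] poly_space_scale[OF qB(1)]]
    unfolding D_def[abs_def] by simp
  have D0: "D C = 0" if "C \<in> X" "C \<noteq> A" "C \<noteq> B" "C \<notin> M" for C
    using qA(3)[of C] qB(3)[of C] that by (simp add: D_def M_def)
  have DP: "D P = 0" using ab(2) by (simp add: D_def)
  have Pl: "P \<notin> l" using P d1 by blast
  have z1: "f1 z = 0" "D z = 0" if "z \<in> m1 \<inter> (X - l)" for z
  proof -
    show "f1 z = 0" using that f1(2) by simp
    show "D z = 0"
      using that DP D0[of z] Mm1[of z] A B by (cases "z = P") blast+
  qed
  have "Suc k \<le> card (m1 \<inter> (X - l))" using maximal_lineD(3)[OF m1] by simp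
  then obtain D1 where "D1 \<in> deg_less (Suc k - 1)" and D1: "D = (\<lambda>z. f1 z * D1 z)"
    by (rule factor_line[OF f1(1) D_in maximal_lineD(2)[OF m1] _ z1])
  then have D1_in: "D1 \<in> deg_less k" by simp
  have z2: "f2 z = 0" "D1 z = 0" if "z \<in> m2 \<inter> (X - l) - {P}" for z
  proof -
    show "f2 z = 0" using that f2(2) by simp
    have "D z = 0" using that D0[of z] Mm2[of z] A B by blast
    moreover have "f1 z \<noteq> 0" using that m12[of z] f1(2) by blast
    ultimately show "D1 z = 0" using fun_cong[OF D1, of z] by simp
  qed
  \<comment> \<open>\<open>P\<close> lies on \<open>m1\<close> as well, so nothing is known about
    \<open>D1\<close> there. The remaining \<open>k\<close> nodes of \<open>m2\<close> just suffice,
    the degree having dropped by one.\<close>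
  have "k \<le> card (m2 \<inter> (X - l) - {P})" using maximal_lineD(2,3)[OF m2] P Pl by simp
  then obtain D2 where D2_in: "D2 \<in> deg_less (k - 1)" and D2: "D1 = (\<lambda>z. f2 z * D2 z)"
    by (rule factor_line[OF f2(1) D1_in finite_Diff[OF maximal_lineD(2)[OF m2]] _ z2])
  have zl: "f z = 0" "D2 z = 0" if "z \<in> l \<inter> X - {A, B, R}" for z
  proof -
    show "f z = 0" using that f(2) by simp
    have "D z = 0" using that D0[of z] Ml[of z] by blast
    moreover have "f1 z \<noteq> 0" "f2 z \<noteq> 0" using that d1 d2 f1(2) f2(2) by blast+
    ultimately show "D2 z = 0" using fun_cong[OF D1, of z] fun_cong[OF D2, of z] by simp
  qed
  \<comment> \<open>Of the \<open>k + 2\<close> nodes of \<open>l\<close>, the vanishing of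
    \<open>D\<close> is unknown only at \<open>A\<close>, \<open>B\<close> and at the point
    \<open>R\<close> of \<open>h = 0\<close>.\<close>
  have "k - 1 \<le> card (l \<inter> X - {A, B, R})"
  proof -
    have "card {A, B, R} \<le> 3" by (simp add: card_insert_if)
    then show ?thesis
      using diff_card_le_card_Diff[of "{A, B, R}" "l \<inter> X"] maximal_lineD(3)[OF l] by simp
  qed
  then obtain D3 where D3: "D2 = (\<lambda>z. f z * D3 z)"
    by (rule factor_line[OF f(1) D2_in finite_Diff[OF maximal_lineD(2)[OF l]] _ zl])
  have Dl: "D z = 0" if "z \<in> l" for z 
    using that f(2) fun_cong[OF D1, of z] fun_cong[OF D2, of z] fun_cong[OF D3, of z] by simp
  \<comment> \<open>Hence \<open>D A\<close> is \<open>a * qA A\<close> and \<open>D B\<close> is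
    \<open>b * qB B\<close>, and both vanish.\<close>
  have "qB A = 0" "qA B = 0" using qA(3)[of B] qB(3)[of A] A B h \<open>A \<noteq> B\<close> by auto
  then have "a = 0" "b = 0" using Dl[of A] Dl[of B] A B qA(2) qB(2) by (auto simp: D_def)
  then show False using ab(1) by simp
qed

section \<open>Existence of three maximal lines\<close>

lemma maximal_lift:
  assumes X: "poised (Suc k) X" and m: "maximal_line k (X - l) m" and B: "B \<in> m" "B \<in> l" "B \<in> X"
  shows "maximal_line (Suc k) X m"
proof (rule maximal_lineI[OF X maximal_lineD(1)[OF m]])
  have "insert B (m \<inter> (X - l)) \<subseteq> m \<inter> X" using B by blast
  then have "card (insert B (m \<inter> (X - l))) \<le> card (m \<inter> X)"
    using poised_finite[OF X] by (intro card_mono) auto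
  then show "Suc k + 1 \<le> card (m \<inter> X)" using B maximal_lineD[OF m] by simp
qed

text \<open>\<open>IH\<close> is the claim one degree lower for the same pair \<open>m1\<close>,
  \<open>m2\<close>. It is applied after deleting \<open>m3\<close> in case \<open>m3\<close> is
  maximal in \<open>X\<close>; degree \<open>k = 1\<close> is beyond its reach and is treated
  directly.\<close>

lemma submaximal_step:
  assumes X: "GC_set (Suc k) X" and k: "1 \<le> k" and l: "maximal_line (Suc k) X l"
    and m1: "maximal_line k (X - l) m1" and m2: "maximal_line k (X - l) m2"
    and m3: "maximal_line k (X - l) m3" and ne: "m1 \<noteq> m2" "m1 \<noteq> m3" "m2 \<noteq> m3"
    and d1: "m1 \<inter> l \<inter> X = {}" and d2: "m2 \<inter> l \<inter> X = {}"
    and IH: "\<And>X' l'. \<lbrakk>2 \<le> k; GC_set k X'; maximal_line k X' l'; maximal_line (k - 1) (X' - l') m1;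
      maximal_line (k - 1) (X' - l') m2\<rbrakk> \<Longrightarrow> m1 \<inter> l' \<inter> X' \<noteq> {} \<or> m2 \<inter> l' \<inter> X' \<noteq> {}"
  shows False
proof -
  note l' = maximal_lineD[OF l]
  have Y: "GC_set k (X - l)" using GC_remove[OF X l] .
  obtain k' where k': "k = Suc k'" using k by (cases k) auto
  obtain P where P: "P \<in> X - l" "P \<in> m1" "P \<in> m2" using maximal_meet[OF GC_poised[OF Y] m1 m2 ne(1)] .
  have nonconc: "Q \<notin> m3" if "Q \<in> m1" "Q \<in> m2" for Q
    using not_concurrent[of k' "X - l" m1 m2 m3 Q] GC_poised[OF Y] m1 m2 m3 ne that by (auto simp: k')
  have "\<exists>L i. node_factors (Suc k) X A L \<and> i < Suc k \<and> L i P = 0" if A: "A \<in> l \<inter> X" for A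
  proof -
    obtain L where L: "node_factors (Suc k) X A L" using X A by (auto simp: GC_set_iff)
    moreover have "P \<in> X - {A}" using P A by blast
    ultimately show ?thesis unfolding node_factors_def by blast
  qed
  then obtain L i where L: "\<And>A. A \<in> l \<inter> X \<Longrightarrow> node_factors (Suc k) X A (L A)"
    and i: "\<And>A. A \<in> l \<inter> X \<Longrightarrow> i A < Suc k" "\<And>A. A \<in> l \<inter> X \<Longrightarrow> L A (i A) P = 0" by metis
  define h where "h A = L A (i A)" for A
  have h: "linear_poly (h A)" "h A A \<noteq> 0" "h A P = 0" if "A \<in> l \<inter> X" for A
    using L[OF that] i[OF that] by (auto simp: h_def node_factors_def)
  \<comment> \<open>The lines \<open>h A\<close> form a pencil through \<open>P\<close>. Two of them
    with a further common point coincide, which \<open>shared_factor_contradiction\<close> excludes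
    for different nodes of \<open>l\<close>.\<close>
  have inj: "A = B" if A: "A \<in> l \<inter> X" and B: "B \<in> l \<inter> X" and Q: "h A Q = 0" "h B Q = 0" "Q \<noteq> P" for A B Q
  proof (rule ccontr)
    assume "A \<noteq> B"
    have same: "{z. h A z = 0} = {z. h B z = 0}"
      using line_eq[OF is_line_zeros[OF h(1)[OF A]] is_line_zeros[OF h(1)[OF B]], of P Q] h(3) A B Q by auto
    obtain R where R: "R \<in> l \<inter> X" "h A R = 0"
      using node_factors_meet_maximal[OF l A L[OF A] i(1)[OF A]] by (auto simp: h_def)
    obtain qA where qA: "qA \<in> poly_space k" "qA A \<noteq> 0" "\<And>C. C \<in> X \<Longrightarrow> C \<noteq> A \<Longrightarrow> h A C \<noteq> 0 \<Longrightarrow> qA C = 0"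
      using node_factors_split[OF L[OF A] i(1)[OF A]] unfolding h_def by blast
    obtain qB where qB: "qB \<in> poly_space k" "qB B \<noteq> 0" "\<And>C. C \<in> X \<Longrightarrow> C \<noteq> B \<Longrightarrow> h B C \<noteq> 0 \<Longrightarrow> qB C = 0"
      using node_factors_split[OF L[OF B] i(1)[OF B]] unfolding h_def by blast
    have hB: "h A C \<noteq> 0 \<longleftrightarrow> h B C \<noteq> 0" for C using same by blast
    show False
      using shared_factor_contradiction[OF l m1 m2 ne(1) d1 d2 P(2,3) DiffD1[OF P(1)] A B \<open>A \<noteq> B\<close>
          h(1,2)[OF A] _ h(3)[OF A] R(2,1) qA qB(1,2)] qB(3) hB h(2)[OF B] by blast
  qed
  show False
  proof (cases "m3 \<inter> l \<inter> X = {}")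
    case d3: True
    have "\<exists>Q\<in>m3 \<inter> (X - l). h A Q = 0" if "A \<in> l \<inter> X" for A
      using node_factors_meet_submaximal[OF l m3 d3 that L[OF that] i(1)[OF that]] by (simp add: h_def)
    then obtain Q where Q: "\<And>A. A \<in> l \<inter> X \<Longrightarrow> Q A \<in> m3 \<inter> (X - l)" "\<And>A. A \<in> l \<inter> X \<Longrightarrow> h A (Q A) = 0"
      by metis
    \<comment> \<open>\<open>Q A\<close> differs from \<open>P\<close> because \<open>P\<close> is
      not on \<open>m3\<close>. Thus the \<open>k + 2\<close> nodes of \<open>l\<close> would inject
      into the \<open>k + 1\<close> nodes of \<open>m3\<close>.\<close>
    have "inj_on Q (l \<inter> X)"
    proof (rule inj_onI)
      fix A B assume "A \<in> l \<inter> X" "B \<in> l \<inter> X" "Q A = Q B"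
      then show "A = B" using inj[of A B "Q A"] Q[of A] Q(2)[of B] nonconc P by (metis IntD1)
    qed
    then have "card (l \<inter> X) \<le> card (m3 \<inter> (X - l))"
      using Q(1) maximal_lineD(2)[OF m3] by (intro card_inj_on_le) auto
    then show False using l'(3) maximal_lineD(3)[OF m3] by simp
  next
    case False
    then obtain B where B: "B \<in> m3" "B \<in> l \<inter> X" by blast
    have m3X: "maximal_line (Suc k) X m3" using maximal_lift[OF GC_poised[OF X] m3 B(1)] B(2) by blast
    have "m3 \<inter> (X - l) \<noteq> {}" using maximal_lineD(3)[OF m3] by auto
    then have "m3 \<noteq> l" by blast
    show False
    proof (cases "2 \<le> k")
      case True
      \<comment> \<open>Deleting \<open>m3\<close> first leaves \<open>l\<close> maximal in a set of
        degree \<open>k\<close>, and \<open>m1\<close>, \<open>m2\<close> maximal after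
        \<open>l\<close> is deleted too.\<close>
      have eq: "X - m3 - l = X - l - m3" by blast
      have "m1 \<inter> l \<inter> (X - m3) \<noteq> {} \<or> m2 \<inter> l \<inter> (X - m3) \<noteq> {}"
      proof (rule IH[OF True GC_remove[OF X m3X] maximal_remove[OF GC_poised[OF X] m3X l \<open>m3 \<noteq> l\<close>]])
        show "maximal_line (k - 1) (X - m3 - l) m1" "maximal_line (k - 1) (X - m3 - l) m2"
          using maximal_remove[of k' "X - l" m3] GC_poised[OF Y] m1 m2 m3 ne unfolding eq k' by auto
      qed
      then show False using d1 d2 by blast
    next
      case False
      then have "k = 1" using k by simp
      \<comment> \<open>For \<open>k = 1\<close> the nodes of \<open>m3\<close> off \<open>l\<close>
        are just \<open>P1\<close> and \<open>P2\<close>, and the two lines used by \<open>B\<close>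
        share them out. So \<open>h B\<close> joins \<open>P\<close> to \<open>P1\<close> or
        \<open>P2\<close> and equals \<open>m1\<close> or \<open>m2\<close>; but \<open>h B\<close>
        meets \<open>l\<close> in a node, unlike these.\<close>
      obtain P1 where P1: "P1 \<in> X - l" "P1 \<in> m1" "P1 \<in> m3" using maximal_meet[OF GC_poised[OF Y] m1 m3 ne(2)] .
      obtain P2 where P2: "P2 \<in> X - l" "P2 \<in> m2" "P2 \<in> m3" using maximal_meet[OF GC_poised[OF Y] m2 m3 ne(3)] .
      have "P1 \<noteq> P2" using nonconc P1 P2 by blast
      have "card (m3 \<inter> (X - l)) = 2" using maximal_lineD(3)[OF m3] \<open>k = 1\<close> by simp
      moreover have "card {P1, P2} = 2" using \<open>P1 \<noteq> P2\<close> by simp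
      moreover have "{P1, P2} \<subseteq> m3 \<inter> (X - l)" using P1 P2 by blast
      ultimately have S: "m3 \<inter> (X - l) = {P1, P2}"
        by (metis card_subset_eq maximal_lineD(2)[OF m3])
      have "\<exists>Q\<in>m3 \<inter> (X - l). L B (i B) Q = 0"
      proof (rule pigeonhole_lines(2)[OF maximal_lineD(1,2)[OF m3] _ _ _ _ _ i(1)[OF B(2)]])
        show "\<exists>i<Suc k. L B i Q = 0" if "Q \<in> m3 \<inter> (X - l)" for Q
        proof -
          have "Q \<in> X - {B}" using that B by blast
          then show ?thesis using L[OF B(2)] unfolding node_factors_def by blast
        qed
        show "linear_poly (L B i)" if "i < Suc k" for i
          using that L[OF B(2)] by (simp add: node_factors_def)
        show "{z. L B i z = 0} \<noteq> m3" if "i < Suc k" for i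
          using that L[OF B(2)] B(1) by (auto simp: node_factors_def)
        show "card (m3 \<inter> (X - l)) = Suc k" using maximal_lineD(3)[OF m3] by simp
      qed auto
      then have "h B P1 = 0 \<or> h B P2 = 0" using S by (auto simp: h_def)
      moreover have "P1 \<noteq> P" "P2 \<noteq> P" using nonconc P P1 P2 by blast+
      moreover have "{z. h B z = 0} \<noteq> m1" "{z. h B z = 0} \<noteq> m2"
        using node_factors_meet_maximal[OF l B(2) L[OF B(2)] i(1)[OF B(2)]] d1 d2 unfolding h_def by blast+
      ultimately show False
        using line_eq[OF is_line_zeros[OF h(1)[OF B(2)]] maximal_lineD(1)[OF m1], of P P1]
          line_eq[OF is_line_zeros[OF h(1)[OF B(2)]] maximal_lineD(1)[OF m2], of P P2] h(3)[OF B(2)] P P1 P2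
        by blast
    qed
  qed
qed

text \<open>The three nodes form a triangle whose sides are three different maximal lines, so some
  side avoids both \<open>a\<close> and \<open>b\<close>.\<close>

lemma GC_1_maximal:
  assumes "GM_upto 1" "GC_set 1 X"
  shows "\<exists>c. maximal_line 1 X c \<and> c \<noteq> a \<and> c \<noteq> b"
proof -
  have card: "card X = 3" using GC_card[OF assms] by (simp add: numeral_eq_Suc)
  have "\<exists>m. is_line m \<and> A \<notin> m \<and> X - {A} \<subseteq> m" if A: "A \<in> X" for A
  proof -
    obtain L where L: "node_factors 1 X A L" using assms(2) A by (auto simp: GC_set_iff)
    then show ?thesis
      by (intro exI[of _ "{z. L 0 z = 0}"]) (auto simp: node_factors_def is_line_zeros)
  qed
  then obtain m where m: "\<And>A. A \<in> X \<Longrightarrow> is_line (m A)" "\<And>A. A \<in> X \<Longrightarrow> A \<notin> m A"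
    "\<And>A. A \<in> X \<Longrightarrow> X - {A} \<subseteq> m A" by metis
  have max: "maximal_line 1 X (m A)" if A: "A \<in> X" for A
  proof (rule maximal_lineI[OF GC_poised[OF assms(2)] m(1)[OF A]])
    have "m A \<inter> X = X - {A}" using m(2,3)[OF A] by blast
    then show "1 + 1 \<le> card (m A \<inter> X)" using card A by simp
  qed
  have "inj_on m X" using m(2,3) by (intro inj_onI) (metis DiffI singletonD subsetD)
  then have "card (m ` X) = 3" using card card_image by metis
  moreover have "card {a, b} \<le> 2" by (simp add: card_insert_if)
  ultimately have "\<not> m ` X \<subseteq> {a, b}" using card_mono[of "{a, b}" "m ` X"] by auto
  then show ?thesis using max by blast
qed

text \<open>A simultaneous induction: three maximal lines in degree \<open>k\<close> supply the
  \<open>m3\<close> of \<open>submaximal_step\<close>, and the resulting claim about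
  \<open>X - l\<close> lifts maximal lines back to degree \<open>k + 1\<close>. Quantifying over
  arbitrary \<open>a\<close>, \<open>b\<close> expresses that there are at least three.\<close>

lemma GC_maximal_lines:
  assumes "GM_upto n" "1 \<le> n" "GC_set n X"
  shows submaximal_meet: "\<And>l m1 m2. \<lbrakk>2 \<le> n; maximal_line n X l; maximal_line (n - 1) (X - l) m1;
        maximal_line (n - 1) (X - l) m2; m1 \<noteq> m2\<rbrakk> \<Longrightarrow> m1 \<inter> l \<inter> X \<noteq> {} \<or> m2 \<inter> l \<inter> X \<noteq> {}"
    and third_maximal: "\<And>a b. \<exists>c. maximal_line n X c \<and> c \<noteq> a \<and> c \<noteq> b"
proof -
  have "(\<forall>l m1 m2. 2 \<le> n \<longrightarrow> maximal_line n X l \<longrightarrow> maximal_line (n - 1) (X - l) m1 \<longrightarrow>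
       maximal_line (n - 1) (X - l) m2 \<longrightarrow> m1 \<noteq> m2 \<longrightarrow> m1 \<inter> l \<inter> X \<noteq> {} \<or> m2 \<inter> l \<inter> X \<noteq> {}) \<and>
     (\<forall>a b. \<exists>c. maximal_line n X c \<and> c \<noteq> a \<and> c \<noteq> b)"
    using assms(2,1,3)
  proof (induction n arbitrary: X rule: dec_induct)
    case base
    then show ?case using GC_1_maximal by auto
  next
    case (step k)
    have GM: "GM_upto k" using GM_upto_mono[OF step.prems(1)] by simp
    note IH = step.IH[OF GM]
    have meet: "m1 \<inter> l \<inter> X \<noteq> {} \<or> m2 \<inter> l \<inter> X \<noteq> {}"
      if l: "maximal_line (Suc k) X l" and m: "maximal_line k (X - l) m1" "maximal_line k (X - l) m2" "m1 \<noteq> m2"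
      for l m1 m2
    proof (rule ccontr)
      assume d: "\<not> ?thesis"
      obtain m3 where m3: "maximal_line k (X - l) m3" "m3 \<noteq> m1" "m3 \<noteq> m2"
        using IH[OF GC_remove[OF step.prems(2) l]] by blast
      show False
      proof (rule submaximal_step[OF step.prems(2) step.hyps(1) l m(1,2) m3(1) m(3) m3(2,3)[symmetric]])
        fix X' l' assume "2 \<le> k" "GC_set k X'" "maximal_line k X' l'" "maximal_line (k - 1) (X' - l') m1"
          "maximal_line (k - 1) (X' - l') m2"
        then show "m1 \<inter> l' \<inter> X' \<noteq> {} \<or> m2 \<inter> l' \<inter> X' \<noteq> {}" using IH m(3) by blast
      qed (use d in auto)
    qed
    have third: "\<exists>c. maximal_line (Suc k) X c \<and> c \<noteq> a \<and> c \<noteq> b" for a b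
    proof -
      obtain l where l: "maximal_line (Suc k) X l"
        using GM_upto_maximal[OF step.prems] by auto
      \<comment> \<open>Of two maximal lines of \<open>X - l\<close> other than \<open>b\<close>,
        one meets \<open>l\<close> in a node and is therefore maximal in \<open>X\<close>.\<close>
      have *: "\<exists>c. maximal_line (Suc k) X c \<and> c \<noteq> l \<and> c \<noteq> b" for b
      proof -
        note Y = IH[OF GC_remove[OF step.prems(2) l]]
        obtain m1 where m1: "maximal_line k (X - l) m1" "m1 \<noteq> b" using Y by blast
        obtain m2 where m2: "maximal_line k (X - l) m2" "m2 \<noteq> b" "m2 \<noteq> m1" using Y by blast
        have max: "maximal_line (Suc k) X m \<and> m \<noteq> l"
          if m: "maximal_line k (X - l) m" "m \<inter> l \<inter> X \<noteq> {}" for m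
        proof -
          have "m \<inter> (X - l) \<noteq> {}" using maximal_lineD(3)[OF m(1)] by auto
          then show ?thesis using maximal_lift[OF GC_poised[OF step.prems(2)] m(1)] m(2) by blast
        qed
        show ?thesis using meet[OF l m1(1) m2(1) m2(3)[symmetric]] max m1 m2 by blast
      qed
      show ?thesis using l *[of a] *[of b] by metis
    qed
    show ?case using meet third by (simp only: diff_Suc_1) blast
  qed
  then show "\<And>l m1 m2. \<lbrakk>2 \<le> n; maximal_line n X l; maximal_line (n - 1) (X - l) m1;
        maximal_line (n - 1) (X - l) m2; m1 \<noteq> m2\<rbrakk> \<Longrightarrow> m1 \<inter> l \<inter> X \<noteq> {} \<or> m2 \<inter> l \<inter> X \<noteq> {}"
    "\<And>a b. \<exists>c. maximal_line n X c \<and> c \<noteq> a \<and> c \<noteq> b" by blast+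
qed

section \<open>Sets with exactly three maximal lines\<close>

definition three_maximal ::
    "nat \<Rightarrow> (real \<times> real) set \<Rightarrow> (real \<times> real) set \<Rightarrow> (real \<times> real) set \<Rightarrow> (real \<times> real) set \<Rightarrow> bool" where
  "three_maximal n X a b c \<longleftrightarrow> GC_set n X \<and> {l. maximal_line n X l} = {a, b, c} \<and>
     a \<noteq> b \<and> a \<noteq> c \<and> b \<noteq> c"

lemma three_maximalD:
  assumes "three_maximal n X a b c"
  shows "GC_set n X" "poised n X" "maximal_line n X a" "maximal_line n X b" "maximal_line n X c"
    "a \<noteq> b" "a \<noteq> c" "b \<noteq> c"
    "\<And>l. maximal_line n X l \<Longrightarrow> l = a \<or> l = b \<or> l = c"
proof -
  have "maximal_line n X l \<longleftrightarrow> l \<in> {a, b, c}" for l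
    using assms unfolding three_maximal_def by blast
  then show "maximal_line n X a" "maximal_line n X b" "maximal_line n X c"
    "\<And>l. maximal_line n X l \<Longrightarrow> l = a \<or> l = b \<or> l = c" by simp_all
  show "GC_set n X" "a \<noteq> b" "a \<noteq> c" "b \<noteq> c" using assms by (simp_all add: three_maximal_def)
  then show "poised n X" using GC_poised by simp
qed

lemma three_maximal_rotate: "three_maximal n X a b c \<Longrightarrow> three_maximal n X b c a"
  unfolding three_maximal_def by blast

lemma three_maximal_swap: "three_maximal n X a b c \<Longrightarrow> three_maximal n X b a c"
  unfolding three_maximal_def by blast

lemma three_maximal_swap_last: "three_maximal n X a b c \<Longrightarrow> three_maximal n X a c b"
  by (rule three_maximal_rotate[OF three_maximal_swap])

text \<open>A third maximal line of \<open>X - a\<close> exists by \<open>third_maximal\<close>. It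
  misses the nodes of \<open>a\<close>, since otherwise it would be a fourth maximal line of
  \<open>X\<close>; two such lines would contradict \<open>submaximal_meet\<close>.\<close>

lemma three_maximal_remove:
  assumes GM: "GM_upto (Suc k)" and k: "1 \<le> k" and X: "three_maximal (Suc k) X a b c"
  obtains m where "three_maximal k (X - a) m b c" "m \<inter> a \<inter> X = {}"
proof -
  note X' = three_maximalD[OF X]
  have Y: "GC_set k (X - a)" using GC_remove[OF X'(1,3)] .
  have b: "maximal_line k (X - a) b" and c: "maximal_line k (X - a) c"
    using maximal_remove[OF X'(2,3)] X' by auto
  have GMk: "GM_upto k" using GM_upto_mono[OF GM] by simp
  obtain m where m: "maximal_line k (X - a) m" "m \<noteq> b" "m \<noteq> c"
    using third_maximal[OF GMk k Y, of b c] by blast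
  have miss: "l \<inter> a \<inter> X = {}" if l: "maximal_line k (X - a) l" "l \<noteq> b" "l \<noteq> c" for l
  proof (rule ccontr)
    assume "l \<inter> a \<inter> X \<noteq> {}"
    then have "maximal_line (Suc k) X l" using maximal_lift[OF X'(2) l(1)] by blast
    then have "l = a" using X'(9) l by blast
    then show False using maximal_lineD(3)[OF l(1)] by auto
  qed
  have "l = m" if l: "maximal_line k (X - a) l" "l \<noteq> b" "l \<noteq> c" for l
  proof (rule ccontr)
    assume "l \<noteq> m"
    then have "l \<inter> a \<inter> X \<noteq> {} \<or> m \<inter> a \<inter> X \<noteq> {}"
      using submaximal_meet[OF GM _ X'(1), of a l m] k X'(3) m(1) l(1) by simp
    then show False using miss[OF l] miss[OF m] by blast
  qed
  then have "{l. maximal_line k (X - a) l} = {m, b, c}" using m(1) b c by blast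
  then show ?thesis using that[of m] miss[OF m] Y m X'(8) by (simp add: three_maximal_def)
qed

text \<open>For a principal lattice with sides \<open>a\<close>, \<open>b\<close>, \<open>c\<close>, the line \<open>a'\<close> is the lattice line
  parallel to \<open>a\<close> and next to it.\<close>

definition companions ::
    "nat \<Rightarrow> (real \<times> real) set \<Rightarrow> (real \<times> real) set \<Rightarrow> (real \<times> real) set \<Rightarrow> (real \<times> real) set \<Rightarrow>
      (real \<times> real) set \<Rightarrow> (real \<times> real) set \<Rightarrow> (real \<times> real) set \<Rightarrow> bool" where
  "companions k X a b c a' b' c' \<longleftrightarrow> three_maximal (Suc k) X a b c \<and>
     three_maximal k (X - a) a' b c \<and> three_maximal k (X - b) b' a c \<and> three_maximal k (X - c) c' a b \<and>
     a' \<inter> a \<inter> X = {} \<and> b' \<inter> b \<inter> X = {} \<and> c' \<inter> c \<inter> X = {}"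

section \<open>Existence and symmetry of the companion lines\<close>

lemma companions_exist:
  assumes "GM_upto (Suc k)" "1 \<le> k" "three_maximal (Suc k) X a b c"
  obtains a' b' c' where "companions k X a b c a' b' c'"
proof -
  obtain a' where "three_maximal k (X - a) a' b c" "a' \<inter> a \<inter> X = {}"
    using three_maximal_remove[OF assms] .
  moreover obtain b' where "three_maximal k (X - b) b' a c" "b' \<inter> b \<inter> X = {}"
    using three_maximal_remove[OF assms(1,2) three_maximal_swap[OF assms(3)]] .
  moreover obtain c' where "three_maximal k (X - c) c' a b" "c' \<inter> c \<inter> X = {}"
    using three_maximal_remove[OF assms(1,2) three_maximal_rotate[OF three_maximal_rotate[OF assms(3)]]] .
  ultimately show ?thesis using that assms(3) by (simp add: companions_def)
qed

lemma companions_rotate: "companions k X a b c a' b' c' \<Longrightarrow> companions k X b c a b' c' a'"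
  unfolding companions_def
  by (intro conjI; elim conjE) (assumption | erule three_maximal_rotate | erule three_maximal_swap_last)+

lemma companions_swap: "companions k X a b c a' b' c' \<Longrightarrow> companions k X b a c b' a' c'"
  unfolding companions_def
  by (intro conjI; elim conjE) (assumption | erule three_maximal_swap | erule three_maximal_swap_last)+

lemma companionsD:
  assumes "companions k X a b c a' b' c'"
  shows "three_maximal (Suc k) X a b c" "three_maximal k (X - a) a' b c"
    "three_maximal k (X - b) b' a c" "three_maximal k (X - c) c' a b"
    "a' \<inter> a \<inter> X = {}" "b' \<inter> b \<inter> X = {}" "c' \<inter> c \<inter> X = {}"
  using assms by (simp_all add: companions_def)

text \<open>\<open>a'\<close> meets \<open>b\<close> in a node, being maximal together with it in
  \<open>X - a\<close>, whereas \<open>b'\<close> misses the nodes of \<open>b\<close>.\<close>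

lemma companions_distinct:
  assumes "companions k X a b c a' b' c'"
  shows "a' \<noteq> b'"
proof -
  note C = companionsD[OF assms]
  note Y = three_maximalD[OF C(2)]
  obtain P where "P \<in> X - a" "P \<in> a'" "P \<in> b" using maximal_meet[OF Y(2,3,4,6)] .
  then show ?thesis using C(6) by blast
qed

lemma companion_node_line:
  assumes "companions k X a b c a' b' c'"
  shows "node_line (Suc k) X a'"
proof -
  note C = companionsD[OF assms]
  note m = maximal_lineD[OF three_maximalD(3)[OF C(2)]]
  have "a' \<inter> X = a' \<inter> (X - a)" using C(5) by blast
  then show ?thesis using m by (simp add: node_line_def)
qed

lemma node_line_not_maximal:
  assumes "node_line n X N" "maximal_line n X l"
  shows "N \<noteq> l"
  using assms by (auto simp: node_line_def maximal_line_def)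

lemma node_lineD:
  assumes "node_line n X N"
  shows "is_line N" "finite (N \<inter> X)" "card (N \<inter> X) = n"
  using assms by (auto simp: node_line_def)

section \<open>How an \<open>n\<close>-node line can meet the maximal lines\<close>

text \<open>Removing \<open>a\<close> and \<open>b\<close> costs \<open>N\<close> only the node
  \<open>P\<close>, so \<open>N\<close> is maximal in \<open>X - a - b\<close>, and so is
  \<open>b'\<close>. Neither meets \<open>b\<close> in a node of \<open>X - a\<close>, against
  \<open>submaximal_meet\<close> for \<open>X - a\<close> and \<open>b\<close>.\<close>

lemma node_line_avoids_vertex:
  assumes GM: "GM_upto (Suc k)" and k: "2 \<le> k" and comp: "companions k X a b c a' b' c'"
    and N: "node_line (Suc k) X N" and P: "P \<in> N" "P \<in> a" "P \<in> b" "P \<in> X"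
  shows False
proof -
  note C = companionsD[OF comp]
  note X = three_maximalD[OF C(1)] and Ya = three_maximalD[OF C(2)] and Yb = three_maximalD[OF C(3)]
  note N' = node_lineD[OF N]
  have lines: "is_line a" "is_line b" using X maximal_lineD(1) by blast+
  have ne: "N \<noteq> a" "N \<noteq> b" using node_line_not_maximal[OF N] X by auto
  have Na: "Q = P" if "Q \<in> N" "Q \<in> a" for Q using line_eq[OF N'(1) lines(1)] ne that P by blast
  have Nb: "Q = P" if "Q \<in> N" "Q \<in> b" for Q using line_eq[OF N'(1) lines(2)] ne that P by blast
  obtain k' where k': "k = Suc k'" using k by (cases k) auto
  have "N \<inter> (X - a - b) = N \<inter> X - {P}" using Na Nb P by blast
  then have "card (N \<inter> (X - a - b)) = k" using N' P by simp
  then have "maximal_line k' (X - a - b) N"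
    using maximal_lineI[OF _ N'(1)] poised_remove[of k' "X - a" b] Ya(2,4) k' by simp
  moreover have "maximal_line k' (X - b - a) b'"
    using maximal_remove[of k' "X - b" a b'] Yb k' by simp
  moreover have "X - b - a = X - a - b" by blast
  moreover have "N \<noteq> b'" using P C(6) by blast
  ultimately have "N \<inter> b \<inter> (X - a) \<noteq> {} \<or> b' \<inter> b \<inter> (X - a) \<noteq> {}"
    using submaximal_meet[OF GM_upto_mono[OF GM] _ Ya(1), of b N b'] k Ya(4) k' by simp
  then show False using Nb P C(6) by blast
qed

text \<open>Removing \<open>a\<close>, \<open>b\<close> and \<open>a'\<close> lowers the degree by
  three but costs \<open>N\<close> only \<open>A\<close> and \<open>B\<close>, so \<open>N\<close>
  becomes maximal. \<open>b'\<close> is maximal there too, and two maximal lines must share a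
  node.\<close>

lemma node_line_step:
  assumes GM: "GM_upto (Suc k)" and k: "2 \<le> k" and comp: "companions k X a b c a' b' c'"
    and N: "node_line (Suc k) X N"
    and A: "A \<in> N" "A \<in> a" "A \<in> X" and B: "B \<in> N" "B \<in> b" "B \<in> X"
    and a': "N \<inter> a' \<inter> X = {}" and b': "N \<inter> b' \<inter> X = {}"
  shows False
proof -
  note C = companionsD[OF comp]
  note X = three_maximalD[OF C(1)] and Ya = three_maximalD[OF C(2)] and Yb = three_maximalD[OF C(3)]
  note N' = node_lineD[OF N]
  obtain j where j: "k = Suc (Suc j)" using k by (metis One_nat_def Suc_1 Suc_le_D Suc_le_mono)
  have lines: "is_line a" "is_line b" using X maximal_lineD(1) by blast+
  have ne: "N \<noteq> a" "N \<noteq> b" using node_line_not_maximal[OF N] X by auto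
  have Na: "Q = A" if "Q \<in> N" "Q \<in> a" for Q using line_eq[OF N'(1) lines(1)] ne that A by blast
  have Nb: "Q = B" if "Q \<in> N" "Q \<in> b" for Q using line_eq[OF N'(1) lines(2)] ne that B by blast
  have "A \<noteq> B" using node_line_avoids_vertex[OF GM k comp N] A B by blast
  let ?W = "X - a - b"
  have W: "poised (Suc j) ?W" using poised_remove[of "Suc j" "X - a" b] Ya(2,4) j by simp
  have a'W: "maximal_line (Suc j) ?W a'"
    using maximal_remove[of "Suc j" "X - a" b a'] Ya j by simp
  have "maximal_line (Suc j) (X - b - a) b'"
    using maximal_remove[of "Suc j" "X - b" a b'] Yb j by simp
  moreover have "X - b - a = ?W" by blast
  ultimately have b'W: "maximal_line (Suc j) ?W b'" by simp
  have "N \<inter> (?W - a') = N \<inter> X - {A, B}" using Na Nb A B a' by blast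
  then have "card (N \<inter> (?W - a')) = Suc j" using N' A B \<open>A \<noteq> B\<close> j by (simp add: card_Diff_subset)
  then have "maximal_line j (?W - a') N"
    using maximal_lineI[OF poised_remove[OF W a'W] N'(1)] by simp
  moreover have "maximal_line j (?W - a') b'"
    using maximal_remove[OF W a'W b'W companions_distinct[OF comp]] .
  moreover have "N \<noteq> b'" using B C(6) by blast
  ultimately obtain Q where "Q \<in> ?W - a'" "Q \<in> N" "Q \<in> b'"
    using maximal_meet[OF poised_remove[OF W a'W]] by metis
  then show False using b' by blast
qed

section \<open>The base case: 4-node lines in degree 4\<close>

text \<open>Two different lines cannot both contain the two points of \<open>Z\<close> other than
  \<open>P\<close>.\<close>

lemma triple_two_lines:
  assumes Z: "card Z = 3" and m: "is_line m" "card (m \<inter> Z) = 2" and m': "is_line m'" "card (m' \<inter> Z) = 2"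
    and "m \<noteq> m'" and P: "P \<in> Z" "P \<notin> m"
  shows "P \<in> m'"
proof (rule ccontr)
  assume "P \<notin> m'"
  have fin: "finite Z" using Z card.infinite by fastforce
  have 2: "card (Z - {P}) = 2" using Z P(1) by simp
  have "m \<inter> Z = Z - {P}" using fin m(2) 2 P by (intro card_subset_eq) auto
  moreover have "m' \<inter> Z = Z - {P}" using fin m'(2) 2 \<open>P \<notin> m'\<close> by (intro card_subset_eq) auto
  moreover obtain Q R where "Z - {P} = {Q, R}" "Q \<noteq> R" using 2 by (auto simp: card_2_iff)
  ultimately have "Q \<in> m" "R \<in> m" "Q \<in> m'" "R \<in> m'" by blast+
  then show False using line_eq[OF m(1) m'(1)] \<open>Q \<noteq> R\<close> \<open>m \<noteq> m'\<close> by blast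
qed

lemma core_aux:
  assumes comp: "companions (Suc (Suc j)) X a b c a' b' c'"
  shows "GC_set j (X - a - b - c)" "maximal_line j (X - a - b - c) a'"
proof -
  note Y = three_maximalD[OF companionsD(2)[OF comp]]
  have W: "GC_set (Suc j) (X - a - b)" using GC_remove[OF Y(1,4)] .
  have c: "maximal_line (Suc j) (X - a - b) c" using maximal_remove[OF Y(2,4,5,8)] .
  have a': "maximal_line (Suc j) (X - a - b) a'" using maximal_remove[OF Y(2,4,3) Y(6)[symmetric]] .
  show "GC_set j (X - a - b - c)" using GC_remove[OF W c] .
  show "maximal_line j (X - a - b - c) a'"
    using maximal_remove[OF GC_poised[OF W] c a' Y(7)[symmetric]] .
qed

text \<open>Deleting \<open>a\<close>, \<open>b\<close>, \<open>c\<close> lowers the degree from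
  \<open>j + 3\<close> to \<open>j\<close>. \<open>a'\<close> is maximal after the removal of
  \<open>a\<close> and stays so when \<open>b\<close> and \<open>c\<close> go; rotation gives the
  rest.\<close>

lemma core:
  assumes comp: "companions (Suc (Suc j)) X a b c a' b' c'"
  shows core_GC: "GC_set j (X - a - b - c)"
    and core_lines: "maximal_line j (X - a - b - c) a'" "maximal_line j (X - a - b - c) b'"
      "maximal_line j (X - a - b - c) c'"
proof -
  have "X - b - c - a = X - a - b - c" "X - c - a - b = X - a - b - c" by blast+
  then show "GC_set j (X - a - b - c)" "maximal_line j (X - a - b - c) a'"
    "maximal_line j (X - a - b - c) b'" "maximal_line j (X - a - b - c) c'"
    using core_aux[OF comp] core_aux[OF companions_rotate[OF comp]]
      core_aux[OF companions_rotate[OF companions_rotate[OF comp]]] by simp_all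
qed

text \<open>The index \<open>Suc (Suc 1)\<close> means that \<open>X\<close> has degree 4, so the
  core is a triangle with sides \<open>a'\<close>, \<open>b'\<close>, \<open>c'\<close>. A core node
  off one side is the vertex where the other two meet.\<close>

lemma core_pair:
  assumes GM: "GM_upto 4" and comp: "companions (Suc (Suc 1)) X a b c a' b' c'"
    and P: "P \<in> X - a - b - c" "P \<notin> a'"
  shows "P \<in> b'" "P \<in> c'"
proof -
  have Z: "card (X - a - b - c) = 3"
    using GC_card[OF GM_upto_mono[OF GM] core_GC[OF comp]] by (simp add: numeral_eq_Suc)
  note L = core_lines[OF comp]
  have "c' \<noteq> a'" using companions_distinct[OF companions_rotate[OF companions_rotate[OF comp]]] .
  then show "P \<in> b'" "P \<in> c'"
    using triple_two_lines[OF Z _ _ _ _ _ P] maximal_lineD[OF L(1)] maximal_lineD[OF L(2)]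
      maximal_lineD[OF L(3)] companions_distinct[OF comp] by auto
qed

lemma core_unique:
  assumes GM: "GM_upto 4" and comp: "companions (Suc (Suc 1)) X a b c a' b' c'"
    and P: "P \<in> X - a - b - c" "P \<notin> a'" and Q: "Q \<in> X - a - b - c" "Q \<notin> a'"
  shows "P = Q"
proof -
  note lines = maximal_lineD(1)[OF core_lines(2)[OF comp]] maximal_lineD(1)[OF core_lines(3)[OF comp]]
  show ?thesis
    using line_eq[OF lines, of P Q] core_pair[OF GM comp P] core_pair[OF GM comp Q]
      companions_distinct[OF companions_rotate[OF comp]] by blast
qed

text \<open>For a principal lattice of degree 4 with sides \<open>a\<close>, \<open>b\<close>, \<open>c\<close>, this is the midpoint of \<open>b\<close>.\<close>

definition free_node ::
    "(real \<times> real) set \<Rightarrow> (real \<times> real) set \<Rightarrow> (real \<times> real) set \<Rightarrow> (real \<times> real) set \<Rightarrow>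
      (real \<times> real) set \<Rightarrow> (real \<times> real) set \<Rightarrow> real \<times> real \<Rightarrow> bool" where
  "free_node X b a c a' c' P \<longleftrightarrow> P \<in> X \<and> P \<in> b \<and> P \<notin> a \<and> P \<notin> c \<and> P \<notin> a' \<and> P \<notin> c'"

text \<open>\<open>b\<close> has five nodes. Its nodes on \<open>a\<close>, \<open>c\<close>,
  \<open>a'\<close> and \<open>c'\<close> are pairwise different, by non-concurrency or because a
  companion misses the nodes of its line, which leaves room for one more.\<close>

lemma free_node_unique:
  assumes comp: "companions (Suc (Suc 1)) X a b c a' b' c'"
    and P: "free_node X b a c a' c' P" and Q: "free_node X b a c a' c' Q"
  shows "P = Q"
proof (rule ccontr)
  assume "P \<noteq> Q"
  note C = companionsD[OF comp]
  note X = three_maximalD[OF C(1)] and Ya = three_maximalD[OF C(2)] and Yc = three_maximalD[OF C(4)]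
  obtain Ra where Ra: "Ra \<in> X" "Ra \<in> a" "Ra \<in> b" using maximal_meet[OF X(2,3,4,6)] .
  obtain Rc where Rc: "Rc \<in> X" "Rc \<in> b" "Rc \<in> c" using maximal_meet[OF X(2,4,5,8)] .
  obtain Ra' where Ra': "Ra' \<in> X - a" "Ra' \<in> a'" "Ra' \<in> b" using maximal_meet[OF Ya(2,3,4,6)] .
  obtain Rc' where Rc': "Rc' \<in> X - c" "Rc' \<in> c'" "Rc' \<in> b" using maximal_meet[OF Yc(2,3,5,7)] .
  have "a' \<noteq> c'" using companions_distinct[OF companions_rotate[OF companions_rotate[OF comp]]] by blast
  have eq: "X - c - a = X - a - c" by blast
  have W: "poised (Suc 1) (X - a - c)" using poised_remove[OF Ya(2,5)] .
  have max: "maximal_line (Suc 1) (X - a - c) a'" "maximal_line (Suc 1) (X - a - c) b"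
    "maximal_line (Suc 1) (X - a - c) c'"
    using maximal_remove[OF Ya(2,5,3) Ya(7)[symmetric]] maximal_remove[OF Ya(2,5,4) Ya(8)[symmetric]]
      maximal_remove[OF Yc(2,4,3) Yc(6)[symmetric], unfolded eq] .
  have "Ra \<noteq> Rc" using not_concurrent[OF X(2,3,4,5,6,7,8)] Ra Rc by blast
  moreover have "Ra \<noteq> Ra'" using Ra Ra' by blast
  moreover have "Rc \<noteq> Rc'" using Rc Rc' by blast
  moreover have "Ra \<noteq> Rc'"
    using not_concurrent[OF Yc(2-8), of Ra] Ra Rc' by blast
  moreover have "Rc \<noteq> Ra'"
    using not_concurrent[OF Ya(2-8), of Rc] Rc Ra' by blast
  moreover have "Ra' \<noteq> Rc'"
    using not_concurrent[OF W max Ya(6) \<open>a' \<noteq> c'\<close> Yc(7)[symmetric], of Ra'] Ra' Rc' by blast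
  moreover have "Ra \<notin> {P, Q}" "Rc \<notin> {P, Q}" "Ra' \<notin> {P, Q}" "Rc' \<notin> {P, Q}"
    using P Q Ra Rc Ra' Rc' by (auto simp: free_node_def)
  ultimately have six: "card {Ra, Rc, Ra', Rc', P, Q} = 6" using \<open>P \<noteq> Q\<close> by simp
  have sub: "{Ra, Rc, Ra', Rc', P, Q} \<subseteq> b \<inter> X"
    using P Q Ra Rc Ra' Rc' by (auto simp: free_node_def)
  have "card (b \<inter> X) = 5" using maximal_lineD(3)[OF X(4)] by simp
  then show False using card_mono[OF maximal_lineD(2)[OF X(4)] sub] six by simp
qed

text \<open>Removing \<open>a\<close> and then \<open>a'\<close> leaves degree 2 with maximal lines
  \<open>m\<close>, \<open>b\<close>, \<open>c\<close>. The three nodes of \<open>m\<close> are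
  \<open>P\<close> on \<open>b\<close>, \<open>Q\<close> on \<open>c\<close> and a core node
  \<open>R\<close>. As \<open>R\<close> lies on \<open>b'\<close> and \<open>c'\<close>, these lines
  contain no other point of \<open>m\<close>.\<close>

lemma free_nodes_collinear:
  assumes GM: "GM_upto 4" and comp: "companions (Suc (Suc 1)) X a b c a' b' c'"
  obtains m P Q R where "is_line m" "P \<in> m" "Q \<in> m" "R \<in> m"
    "free_node X b a c a' c' P" "free_node X c a b a' b' Q" "R \<in> X - a - b - c" "R \<notin> a'"
proof -
  note C = companionsD[OF comp]
  note Ya = three_maximalD[OF C(2)]
  have "GM_upto (Suc (Suc 1))" using GM_upto_mono[OF GM] by simp
  then obtain m where m: "three_maximal (Suc 1) (X - a - a') m b c"
    using three_maximal_remove[OF _ _ C(2)] by (metis le_SucI order_refl)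
  note V = three_maximalD[OF m]
  have lm: "is_line m" using maximal_lineD(1)[OF V(3)] .
  obtain P where P: "P \<in> X - a - a'" "P \<in> m" "P \<in> b" using maximal_meet[OF V(2,3,4,6)] .
  obtain Q where Q: "Q \<in> X - a - a'" "Q \<in> m" "Q \<in> c" using maximal_meet[OF V(2,3,5,7)] .
  have "T \<notin> c" if "T \<in> m" "T \<in> b" for T
    using not_concurrent[OF V(2-8) that] by blast
  then have Pc: "P \<notin> c" and Qb: "Q \<notin> b" and "P \<noteq> Q" using P Q by blast+
  have "card (m \<inter> (X - a - a') - {P, Q}) = 1"
    using maximal_lineD(3)[OF V(3)] P Q \<open>P \<noteq> Q\<close> by (simp add: card_Diff_subset)
  then obtain R where "m \<inter> (X - a - a') - {P, Q} = {R}" by (auto simp: card_1_singleton_iff)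
  then have R: "R \<in> m" "R \<in> X - a - a'" "R \<noteq> P" "R \<noteq> Q" by blast+
  have "R \<notin> b" using line_eq[OF lm maximal_lineD(1)[OF V(4)], of P R] V(6) P R by blast
  moreover have "R \<notin> c" using line_eq[OF lm maximal_lineD(1)[OF V(5)], of Q R] V(7) Q R by blast
  ultimately have RZ: "R \<in> X - a - b - c" "R \<notin> a'" using R by blast+
  note pair = core_pair[OF GM comp RZ]
  have lines: "is_line b'" "is_line c'" using core_lines[OF comp] maximal_lineD(1) by blast+
  have "m \<noteq> c'" using Q C(7) by blast
  then have "P \<notin> c'" using line_eq[OF lm lines(2), of P R] P R pair by blast
  moreover have "m \<noteq> b'" using P C(6) by blast
  then have "Q \<notin> b'" using line_eq[OF lm lines(1), of Q R] Q R pair by blast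
  ultimately show ?thesis
    using that[OF lm P(2) Q(2) R(1)] P Q Pc Qb RZ by (simp add: free_node_def)
qed

text \<open>\<open>R\<close> lies on \<open>b'\<close> and \<open>c'\<close>, so \<open>A\<close> is
  the free node of \<open>a\<close>. First \<open>N\<close> is identified with the line
  \<open>m\<close> of \<open>free_nodes_collinear\<close>, then with the analogous line
  \<open>m2\<close> obtained by exchanging \<open>a\<close> and \<open>b\<close>. The core node on
  \<open>m2\<close> is off \<open>b'\<close>, but \<open>R\<close> is on it.\<close>

lemma node_line_4_aux:
  assumes GM: "GM_upto 4" and comp: "companions (Suc (Suc 1)) X a b c a' b' c'" and N: "node_line 4 X N"
    and A: "A \<in> N" "A \<in> a" "A \<in> X" and B: "B \<in> N" "B \<in> b" "B \<in> X" and C: "C \<in> N" "C \<in> c" "C \<in> X"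
    and R: "N \<inter> (X - a - b - c) = {R}" and Ra': "R \<notin> a'"
  shows False
proof -
  note Co = companionsD[OF comp]
  note X = three_maximalD[OF Co(1)]
  note N' = node_lineD[OF N]
  have GM': "GM_upto (Suc (Suc (Suc 1)))" and N'': "node_line (Suc (Suc (Suc 1))) X N"
    using GM N by (simp_all add: numeral_eq_Suc)
  have vertex: "P \<notin> N \<or> P \<notin> l \<or> P \<notin> m" if "companions (Suc (Suc 1)) X l m r l' m' r'" "P \<in> X" for P l m r l' m' r'
    using node_line_avoids_vertex[OF GM' _ that(1) N'', of P] that(2) by auto
  note rot = companions_rotate[OF comp]
  note rot2 = companions_rotate[OF rot]
  have off: "A \<notin> b" "A \<notin> c" "B \<notin> a" "B \<notin> c" "C \<notin> a" "C \<notin> b"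
    using vertex[OF comp] vertex[OF rot] vertex[OF rot2] A B C by blast+
  have RX: "R \<in> N" "R \<in> X - a - b - c" using R by blast+
  note pair = core_pair[OF GM comp RX(2) Ra']
  have l: "is_line a'" "is_line b'" "is_line c'"
    using core_lines[OF comp] maximal_lineD(1) by blast+
  have ne: "N \<noteq> a'" "N \<noteq> b'" "N \<noteq> c'" using A B C Co(5,6,7) by blast+
  have Nb': "P \<notin> b'" if "P \<in> N" "P \<noteq> R" for P
    using line_eq[OF N'(1) l(2), of P R] ne that RX pair by blast
  have Nc': "P \<notin> c'" if "P \<in> N" "P \<noteq> R" for P
    using line_eq[OF N'(1) l(3), of P R] ne that RX pair by blast
  have ABC: "A \<noteq> R" "B \<noteq> R" "C \<noteq> R" using A B C RX by blast+
  have fA: "free_node X a b c b' c' A"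
    using A off ABC Nb' Nc' by (simp add: free_node_def)
  obtain m P Q S where m: "is_line m" "P \<in> m" "Q \<in> m" "S \<in> m" and P: "free_node X b a c a' c' P"
    and Q: "free_node X c a b a' b' Q" and S: "S \<in> X - a - b - c" "S \<notin> a'"
    using free_nodes_collinear[OF GM comp] .
  obtain m2 P2 Q2 S2 where m2: "is_line m2" "P2 \<in> m2" "Q2 \<in> m2" "S2 \<in> m2"
    and P2: "free_node X a b c b' c' P2" and Q2: "free_node X c b a b' a' Q2"
    and S2: "S2 \<in> X - b - a - c" "S2 \<notin> b'"
    using free_nodes_collinear[OF GM companions_swap[OF comp]] .
  have uniq_b: "B = P" if "B \<notin> a'"
    using free_node_unique[OF comp _ P] B off ABC Nc' that by (simp add: free_node_def)
  have uniq_c: "T = Q" if "free_node X c a b a' b' T" for T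
    using free_node_unique[OF companions_rotate[OF companions_swap[OF comp]], of T Q] that Q
    by (auto simp: free_node_def)
  have "P2 = A"
    using free_node_unique[OF companions_swap[OF comp] P2 fA] .
  have "Q2 = Q" using uniq_c[of Q2] Q2 by (auto simp: free_node_def)
  have "S = R" using core_unique[OF GM comp S RX(2) Ra'] .
  \<comment> \<open>At most one of \<open>B\<close>, \<open>C\<close> lies on \<open>a'\<close>, so
    the other is a free node and hence on \<open>m\<close>, as \<open>R\<close> is.\<close>
  have "N = m"
  proof (cases "B \<in> a'")
    case False
    then have "B \<in> m" using uniq_b m by simp
    then show ?thesis using line_eq[OF N'(1) m(1), of B R] B RX m \<open>S = R\<close> ABC by blast
  next
    case True
    have "B \<noteq> C" using B off by blast
    then have "C \<notin> a'" using line_eq[OF N'(1) l(1), of B C] True ne B C by blast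
    then have "free_node X c a b a' b' C" using C off ABC Nb' by (simp add: free_node_def)
    then have "C \<in> m" using uniq_c m by blast
    then show ?thesis using line_eq[OF N'(1) m(1), of C R] C RX m \<open>S = R\<close> ABC by blast
  qed
  moreover have "A \<noteq> Q" using A Q by (auto simp: free_node_def)
  ultimately have "N = m2"
    using line_eq[OF N'(1) m2(1), of A Q] A m m2 \<open>P2 = A\<close> \<open>Q2 = Q\<close> by blast
  then have "S2 \<in> N \<inter> (X - a - b - c)" using m2 S2(1) by blast
  then have "S2 = R" unfolding R by simp
  then show False using S2(2) pair(1) by simp
qed

text \<open>\<open>A\<close>, \<open>B\<close>, \<open>C\<close> are different because
  \<open>N\<close> avoids the vertices, so the fourth node \<open>R\<close> is in the core. The
  companions are not concurrent, so \<open>R\<close> is off one of them; rotation makes it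
  \<open>a'\<close>.\<close>

lemma node_line_4:
  assumes GM: "GM_upto 4" and comp: "companions (Suc (Suc 1)) X a b c a' b' c'" and N: "node_line 4 X N"
    and A: "A \<in> N" "A \<in> a" "A \<in> X" and B: "B \<in> N" "B \<in> b" "B \<in> X" and C: "C \<in> N" "C \<in> c" "C \<in> X"
  shows False
proof -
  note X = three_maximalD[OF companionsD(1)[OF comp]]
  note N' = node_lineD[OF N]
  note rot = companions_rotate[OF comp]
  note rot2 = companions_rotate[OF rot]
  have GM': "GM_upto (Suc (Suc (Suc 1)))" and N'': "node_line (Suc (Suc (Suc 1))) X N"
    using GM N by (simp_all add: numeral_eq_Suc)
  have vertex: "P \<notin> N \<or> P \<notin> l \<or> P \<notin> m" if "companions (Suc (Suc 1)) X l m r l' m' r'" "P \<in> X" for P l m r l' m' r'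
    using node_line_avoids_vertex[OF GM' _ that(1) N'', of P] that(2) by auto
  have ABC: "A \<noteq> B" "A \<noteq> C" "B \<noteq> C"
    using vertex[OF comp] vertex[OF rot] vertex[OF rot2] A B C by blast+
  have "card (N \<inter> X - {A, B, C}) = 1"
    using N' A B C ABC by (simp add: card_Diff_subset)
  then obtain R where R: "N \<inter> X - {A, B, C} = {R}" by (auto simp: card_1_singleton_iff)
  have ne: "N \<noteq> a" "N \<noteq> b" "N \<noteq> c" using node_line_not_maximal[OF N''] X(3-5) by blast+
  have lines: "is_line a" "is_line b" "is_line c" using X(3-5) maximal_lineD(1) by blast+
  have a: "P = A" if "P \<in> N" "P \<in> a" for P using line_eq[OF N'(1) lines(1)] ne that A by blast
  have b: "P = B" if "P \<in> N" "P \<in> b" for P using line_eq[OF N'(1) lines(2)] ne that B by blast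
  have c: "P = C" if "P \<in> N" "P \<in> c" for P using line_eq[OF N'(1) lines(3)] ne that C by blast
  have NZ: "N \<inter> (X - a - b - c) = {R}" using R a b c A B C by blast
  have eq: "X - b - c - a = X - a - b - c" "X - c - a - b = X - a - b - c" by blast+
  have "R \<notin> a' \<or> R \<notin> b' \<or> R \<notin> c'"
    using not_concurrent[OF _ _ _ _ companions_distinct[OF comp] companions_distinct[OF rot2, symmetric]
        companions_distinct[OF rot], of 0 "X - a - b - c" R] GC_poised[OF core_GC[OF comp]]
      core_lines[OF comp] unfolding One_nat_def by blast
  then show False
    using node_line_4_aux[OF GM comp N A B C NZ] node_line_4_aux[OF GM rot N B C A]
      node_line_4_aux[OF GM rot2 N C A B] NZ unfolding eq by blast
qed

section \<open>Induction from degree 4\<close>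

text \<open>If \<open>N\<close> met \<open>a\<close>, \<open>b\<close> and \<open>c\<close> in
  nodes, it would be a \<open>k\<close>-node line of \<open>X - a\<close> that still meets
  \<open>b\<close> and \<open>c\<close>, so by induction it misses the nodes of \<open>a'\<close>;
  likewise those of \<open>b'\<close>. This is excluded by \<open>node_line_step\<close>.\<close>

lemma node_line_misses_maximal:
  assumes "4 \<le> n" "GM_upto n" "three_maximal n X a b c" "node_line n X N"
  shows "N \<inter> a \<inter> X = {} \<or> N \<inter> b \<inter> X = {} \<or> N \<inter> c \<inter> X = {}"
  using assms
proof (induction n arbitrary: X a b c rule: dec_induct)
  case base
  have 4: "4 = Suc (Suc (Suc 1))" by simp
  obtain a' b' c' where comp: "companions (Suc (Suc 1)) X a b c a' b' c'"
    using companions_exist[OF base(1)[unfolded 4] _ base(2)[unfolded 4]] by auto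
  show ?case using node_line_4[OF base(1) comp base(3)] by blast
next
  case (step k)
  obtain a' b' c' where comp: "companions k X a b c a' b' c'"
    using companions_exist[OF step.prems(1) _ step.prems(2)] step.hyps by auto
  note C = companionsD[OF comp]
  note X = three_maximalD[OF C(1)]
  note N = node_lineD[OF step.prems(3)]
  have GM: "GM_upto k" using GM_upto_mono[OF step.prems(1)] by simp
  show ?case
  proof (rule ccontr)
    assume "\<not> ?case"
    then obtain P Q R where P: "P \<in> N" "P \<in> a" "P \<in> X" and Q: "Q \<in> N" "Q \<in> b" "Q \<in> X"
      and R: "R \<in> N" "R \<in> c" "R \<in> X" by blast
    have k2: "2 \<le> k" using step.hyps by simp
    have vertex: "P \<notin> N \<or> P \<notin> l \<or> P \<notin> m" if "companions k X l m r l' m' r'" "P \<in> X" for P l m r l' m' r'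
      using node_line_avoids_vertex[OF step.prems(1) k2 that(1) step.prems(3)] that(2) by blast
    note rot = companions_rotate[OF comp]
    note rot2 = companions_rotate[OF rot]
    have off: "P \<notin> b" "Q \<notin> a" "R \<notin> a" "R \<notin> b"
      using vertex[OF comp] vertex[OF rot] vertex[OF rot2] P Q R by blast+
    have node: "node_line k (X - l) N" if "maximal_line (Suc k) X l" "T \<in> N" "T \<in> l" "T \<in> X" for l T
      using card_inter_remove[of l N T X] that N maximal_lineD(1)
        node_line_not_maximal[OF step.prems(3) that(1)] finite_subset[of "N \<inter> (X - l)" "N \<inter> X"]
      by (auto simp: node_line_def)
    have "N \<inter> a' \<inter> (X - a) = {} \<or> N \<inter> b \<inter> (X - a) = {} \<or> N \<inter> c \<inter> (X - a) = {}"
      using step.IH[OF GM C(2) node[OF X(3) P]] .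
    then have a': "N \<inter> a' \<inter> X = {}" using Q R off C(5) by blast
    have "N \<inter> b' \<inter> (X - b) = {} \<or> N \<inter> a \<inter> (X - b) = {} \<or> N \<inter> c \<inter> (X - b) = {}"
      using step.IH[OF GM C(3) node[OF X(4) Q]] .
    then have b': "N \<inter> b' \<inter> X = {}" using P R off C(6) by blast
    show False using node_line_step[OF step.prems(1) k2 comp step.prems(3) P Q a' b'] .
  qed
qed

text \<open>\<open>N\<close> keeps all its nodes in \<open>X - a\<close> and is therefore maximal
  there, while \<open>b\<close> and \<open>c\<close> have too many nodes in \<open>X\<close> to be
  \<open>N\<close>.\<close>

lemma node_line_companion:
  assumes comp: "companions k X a b c a' b' c'" and N: "node_line (Suc k) X N" and miss: "N \<inter> a \<inter> X = {}"
  shows "N = a'"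
proof -
  note C = companionsD[OF comp]
  note X = three_maximalD[OF C(1)] and Y = three_maximalD[OF C(2)]
  note N' = node_lineD[OF N]
  have "N \<inter> (X - a) = N \<inter> X" using miss by blast
  then have "maximal_line k (X - a) N" using N' by (simp add: maximal_line_def node_line_def)
  then show ?thesis using Y(9) node_line_not_maximal[OF N X(4)] node_line_not_maximal[OF N X(5)] by blast
qed

lemma node_lines_eq_companions:
  assumes "4 \<le> Suc k" "GM_upto (Suc k)" and comp: "companions k X a b c a' b' c'"
  shows "{l. node_line (Suc k) X l} = {a', b', c'}"
proof -
  note rot = companions_rotate[OF comp]
  note rot2 = companions_rotate[OF rot]
  have "N = a' \<or> N = b' \<or> N = c'" if "node_line (Suc k) X N" for N
    using node_line_misses_maximal[OF assms(1,2) companionsD(1)[OF comp] that]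
      node_line_companion[OF comp that] node_line_companion[OF rot that] node_line_companion[OF rot2 that]
    by blast
  then show ?thesis
    using companion_node_line[OF comp] companion_node_line[OF rot] companion_node_line[OF rot2] by blast
qed

section \<open>The nodes using a companion line\<close>

text \<open>If a node \<open>A\<close> of \<open>a\<close> used \<open>a'\<close>, the cofactor of
  degree \<open>k\<close> would vanish at the other \<open>k + 1\<close> nodes of \<open>a\<close>,
  since \<open>a'\<close> misses them, and thus at \<open>A\<close> as well. Conversely, for
  \<open>A\<close> off both lines, the fundamental polynomial is divisible first by \<open>f\<close>
  and then by \<open>g\<close>.\<close>

lemma uses_companion_iff:
  assumes comp: "companions k X a b c a' b' c'" and A: "A \<in> X"
  shows "uses_line (Suc k) X A a' \<longleftrightarrow> A \<notin> a \<and> A \<notin> a'"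
proof -
  note C = companionsD[OF comp]
  note X = three_maximalD[OF C(1)] and Y = three_maximalD[OF C(2)]
  note p = fundamental_poly[OF X(2) A]
  let ?p = "fundamental_poly (Suc k) X A"
  obtain f where f: "linear_poly f" "a = {z. f z = 0}" using maximal_lineD(1)[OF X(3)] by (rule is_lineE)
  obtain g where g: "linear_poly g" "a' = {z. g z = 0}" "defines_line g a'"
    using maximal_lineD(1)[OF Y(3)] by (rule is_lineE)
  show ?thesis
  proof
    assume "uses_line (Suc k) X A a'"
    then obtain h q where h: "defines_line h a'" and q: "q \<in> poly_space k" and eq: "?p = (\<lambda>z. h z * q z)"
      by (auto simp: uses_line_def)
    have ha': "a' = {z. h z = 0}" using h by (simp add: defines_line_def)
    have "h A * q A = 1" using fun_cong[OF eq, of A] p(2) by simp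
    then have hq: "h A \<noteq> 0" "q A \<noteq> 0" by auto
    have "A \<notin> a"
    proof
      assume "A \<in> a"
      have zero: "f z = 0" "q z = 0" if "z \<in> a \<inter> X - {A}" for z
      proof -
        show "f z = 0" using that f(2) by simp
        have "h z * q z = 0" using fun_cong[OF eq, of z] p(3)[of z] that by simp
        moreover have "h z \<noteq> 0" using that C(5) ha' by blast
        ultimately show "q z = 0" by simp
      qed
      have q_in: "q \<in> deg_less (Suc k)" using q by simp
      have "Suc k \<le> card (a \<inter> X - {A})" using maximal_lineD(2,3)[OF X(3)] A \<open>A \<in> a\<close> by simp
      then obtain r where r: "q = (\<lambda>z. f z * r z)"
        by (rule factor_line[OF f(1) q_in finite_Diff[OF maximal_lineD(2)[OF X(3)]] _ zero])
      then show False using fun_cong[OF r, of A] \<open>A \<in> a\<close> f(2) hq by simp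
    qed
    then show "A \<notin> a \<and> A \<notin> a'" using hq ha' by simp
  next
    assume A': "A \<notin> a \<and> A \<notin> a'"
    have zero: "f z = 0" "?p z = 0" if "z \<in> a \<inter> X" for z
      using that f(2) p(3)[of z] A' by auto
    have p_in: "?p \<in> deg_less (Suc (Suc k))" using p(1) by simp
    have "Suc (Suc k) \<le> card (a \<inter> X)" using maximal_lineD(3)[OF X(3)] by simp
    then obtain q where "q \<in> deg_less (Suc (Suc k) - 1)" and q: "?p = (\<lambda>z. f z * q z)"
      by (rule factor_line[OF f(1) p_in maximal_lineD(2)[OF X(3)] _ zero])
    then have q_in: "q \<in> deg_less (Suc k)" by simp
    have zero': "g z = 0" "q z = 0" if "z \<in> a' \<inter> (X - a)" for z
    proof -
      show "g z = 0" using that g(2) by simp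
      have "f z * q z = 0" using fun_cong[OF q, of z] p(3)[of z] that A' by auto
      then show "q z = 0" using that f(2) by simp
    qed
    have "Suc k \<le> card (a' \<inter> (X - a))" using maximal_lineD(3)[OF Y(3)] by simp
    then obtain r where r_in: "r \<in> deg_less (Suc k - 1)" and r: "q = (\<lambda>z. g z * r z)"
      by (rule factor_line[OF g(1) q_in maximal_lineD(2)[OF Y(3)] _ zero'])
    have "(\<lambda>z. f z * r z) \<in> deg_less (1 + k)"
      using deg_less_mult[OF linear_poly_in[OF f(1)]] r_in by simp
    then have "(\<lambda>z. f z * r z) \<in> poly_space (Suc k - 1)" by simp
    moreover have "?p = (\<lambda>z. g z * (f z * r z))"
      using q r by (simp add: mult.left_commute)
    ultimately show "uses_line (Suc k) X A a'" using g(3) unfolding uses_line_def by blast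
  qed
qed

text \<open>The users form \<open>X - a - a'\<close>, a \<open>GC\<close> set two degrees below
  \<open>X\<close>.\<close>

lemma card_uses_companion:
  assumes GM: "GM_upto (Suc k)" and k: "1 \<le> k" and comp: "companions k X a b c a' b' c'"
  shows "card {A \<in> X. uses_line (Suc k) X A a'} = Suc k choose 2"
proof -
  note Y = three_maximalD[OF companionsD(2)[OF comp]]
  obtain j where j: "k = Suc j" using k by (cases k) auto
  have "GC_set j (X - a - a')" using GC_remove[of j "X - a" a'] Y(1,3) j by simp
  then have "card (X - a - a') = Suc k choose 2"
    using GC_card[of j] GM_upto_mono[OF GM, of j] j by simp
  moreover have "{A \<in> X. uses_line (Suc k) X A a'} = X - a - a'"
    using uses_companion_iff[OF comp] by blast
  ultimately show ?thesis by simp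
qed

theorem corollary4p4:
  fixes n :: nat and X :: "(real \<times> real) set"
  assumes "n \<ge> 4"
    and "\<And>k. 1 \<le> k \<Longrightarrow> k \<le> n \<Longrightarrow> Gasca_Maeztu k"
    and "GC_set n X"
    and "card {l. maximal_line n X l} = 3"
  shows "card {l. node_line n X l} = 3 \<and>
    (\<forall>l. node_line n X l \<longrightarrow> card {A \<in> X. uses_line n X A l} = n choose 2)"
proof -
  have GM: "GM_upto n" using assms(2) by (simp add: GM_upto_def)
  obtain k where k: "n = Suc k" "1 \<le> k" using assms(1) by (cases n) auto
  obtain a b c where "three_maximal n X a b c"
    using assms(3,4) by (auto simp: three_maximal_def card_3_iff)
  then obtain a' b' c' where comp: "companions k X a b c a' b' c'"
    using companions_exist[of k X a b c] GM k by auto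
  note rot = companions_rotate[OF comp]
  note rot2 = companions_rotate[OF rot]
  have lines: "{l. node_line n X l} = {a', b', c'}"
    using node_lines_eq_companions[OF _ _ comp] assms(1) GM k(1) by simp
  moreover have "a' \<noteq> b'" "b' \<noteq> c'" "c' \<noteq> a'"
    using companions_distinct[OF comp] companions_distinct[OF rot] companions_distinct[OF rot2] .
  moreover have "card {A \<in> X. uses_line n X A l} = n choose 2" if "node_line n X l" for l
  proof -
    have "l \<in> {a', b', c'}" using that lines by blast
    then show ?thesis
      using card_uses_companion[OF _ k(2) comp] card_uses_companion[OF _ k(2) rot]
        card_uses_companion[OF _ k(2) rot2] GM k(1) by auto
  qed
  ultimately show ?thesis by auto
qed

end
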